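(* Let $P(k) = 828k^{3}-756k^{2}+199k-15$. We have $$\sum_{k=1}^{\infty} \frac{4096^{k} \big(5P(k)(H_{2k-1}-H_{k-1})-1656k^{2}+576k-53\big)} {k^{3}(3k-1)(3k-2)\binom{3k}{k} \binom{6k}{3k}^2} = 96 (3\pi^{2}\log2-14\zeta(3))$$ and $$\sum_{k=1}^{\infty} \frac{4096^{k} \left(5P(k)(4H_{6k-1}-3H_{3k-1}-H_{k-1})-\frac{Q(k)}{(3k-1)(3k-2)}\right)} {k^{3}(3k-1)(3k-2)\binom{3k}{k} \binom{6k}{3k}^2} = 192 (7 \zeta(3) + 6 \pi^{2}\log2),$$ where $Q(k) = 22356k^{4}-38232k^{3}+22617k^{2}-5676k+509$.
   Context: For $n\in\{0,1,2,\ldots\}$, $H_n=\sum_{0<j\le n}\frac1j$ denotes the usual harmonic number (so $H_0=0$). $\zeta$ is the Riemann zeta function and $\log$ is the natural logarithm. *)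

theory Defs
  imports "HOL-Analysis.Analysis"
begin

(* The Dirichlet series; this is the Riemann zeta function on the half-line s > 1 only
   (the value for s \<le> 1 is junk). *)
definition zeta :: "real \<Rightarrow> real" where
  "zeta s = (\<Sum>n. 1 / real (Suc n) powr s)"

definition P :: "real \<Rightarrow> real" where
  "P k = 828 * k^3 - 756 * k^2 + 199 * k - 15"

definition Q :: "real \<Rightarrow> real" where
  "Q k = 22356 * k^4 - 38232 * k^3 + 22617 * k^2 - 5676 * k + 509"

definition denom :: "nat \<Rightarrow> real" where
  "denom k = real k ^ 3 * (3 * real k - 1) * (3 * real k - 2)
     * real ((3 * k) choose k) * real ((6 * k) choose (3 * k)) ^ 2"

(* The n-th harmonic number is the library's harm n. The subtractions inside its argument
   are on nat; the summands are only used for k \<ge> 1, where they do not truncate. *)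
definition summand1 :: "nat \<Rightarrow> real" where
  "summand1 k =
     4096 ^ k * (5 * P (real k) * (harm (2 * k - 1) - harm (k - 1))
       - 1656 * real k ^ 2 + 576 * real k - 53) / denom k"

definition summand2 :: "nat \<Rightarrow> real" where
  "summand2 k =
     4096 ^ k * (5 * P (real k) * (4 * harm (6 * k - 1) - 3 * harm (3 * k - 1) - harm (k - 1))
       - Q (real k) / ((3 * real k - 1) * (3 * real k - 2))) / denom k"

end

theory Submission
  imports Defs "HOL-Real_Asymp.Real_Asymp"
begin

text \<open>
  Both series are boundary values of one WZ pair.  Put
  \<open>F(x,y) = 16\<^sup>x \<Gamma>(x+y-1/2)\<^sup>2 \<Gamma>(3x+y) \<Gamma>(x+1)\<^sup>4 / (\<Gamma>(3x+y+1/2)\<^sup>2 \<Gamma>(x+y) \<Gamma>(2x+1))\<close>.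
  There is a rational function \<open>R\<close> such that \<open>G = F R\<close> satisfies
  \<open>F(x+1,y) - F(x,y) = G(x,y+1) - G(x,y)\<close> for all real \<open>x,y\<close> near the points of interest
  (lemma \<open>wz_pair\<close>).  Since \<open>F\<close> decays geometrically in \<open>x\<close>, summation over \<open>y = 1, 2, \<dots>\<close>
  and telescoping give \<open>\<Sum>\<^sub>n G(n,1) = \<Sum>\<^sub>k F(0,k)\<close>.  Here \<open>F(0,k) = 1 / (k-1/2)\<^sup>2\<close>, and
  \<open>96 G(n-1,1)\<close> is \<open>4096\<^sup>n P(n)\<close> divided by the denominator of the series, so that this identity is
  the harmonic-free companion \<open>48 \<pi>\<^sup>2\<close> of the two series.

  Harmonic numbers arise by differentiation.  As the relation holds for real \<open>x\<close> and \<open>y\<close>, its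
  derivative in any direction \<open>(a,b)\<close> is again a telescoping relation (lemma \<open>wz_pair_deriv\<close>), now with
  digamma values at integers and half-integers, that is, with harmonic numbers and multiples of \<open>ln 2\<close>.
  At \<open>y = 1\<close> the logarithmic derivatives of \<open>F\<close> involve, up to rational terms,
  \<open>2A - 3B + 12 ln 2\<close> in the direction of \<open>x\<close> and
  \<open>4A - B\<close> in the direction of \<open>y\<close>, where \<open>A\<close> and \<open>B\<close> stand for \<open>H\<^sub>2\<^sub>n - H\<^sub>n\<close> and \<open>4H\<^sub>6\<^sub>n - 3H\<^sub>3\<^sub>n - H\<^sub>n\<close>.
  So the direction \<open>(-1/2, 3/2)\<close> isolates \<open>5A - 6 ln 2\<close>, the direction \<open>(-2, 1)\<close> isolates \<open>5B - 24 ln 2\<close>, and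
  adding a multiple of the original pair removes the logarithms; lemmas \<open>summand1_eq\<close> and \<open>summand2_eq\<close> verify that the rational
  parts match.

  It remains to sum the derivative over row 0 (lemma \<open>wz_term_deriv_0_sums\<close>).  This gives
  \<open>\<Sum> 1 / (2k+1)\<^sup>2 = \<pi>\<^sup>2 / 8\<close>, \<open>\<Sum> 1 / (2k+1)\<^sup>3 = 7/8 \<zeta>(3)\<close>, and the Euler sum
  \<open>\<Sum> (4 O\<^sub>k\<^sub>+\<^sub>1 - H\<^sub>k - 6 ln 2) / (2k+1)\<^sup>2\<close> with \<open>O\<^sub>k\<close> the sum of the first \<open>k\<close> reciprocal odd numbers.  The last one is
  zero (lemma \<open>odd_harm_euler_sum\<close>), which follows from the symmetry and homogeneity of the double series
  \<open>\<Sum> 1 / (a b (a+b))\<close> with signs.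
\<close>

section \<open>Summation of telescoping pairs\<close>

text \<open>
  Summing the relation of the pair over \<^term>\<open>k\<close> shows that consecutive row sums of \<^term>\<open>f\<close>
  differ by the boundary value \<^term>\<open>g n 0\<close>.  In particular every row inherits summability from
  row 0, and the boundary values add up to the total loss of the row sums, which is everything.
\<close>

lemma wz_pair_sums:
  fixes f g :: "nat \<Rightarrow> nat \<Rightarrow> real"
  assumes pair: "\<And>n k. f (Suc n) k - f n k = g n (Suc k) - g n k"
    and mate: "\<And>n. g n \<longlonglongrightarrow> 0"
    and vanish: "(\<lambda>n. \<Sum>k. f n k) \<longlonglongrightarrow> 0"
    and start: "f 0 sums S"
  shows "(\<lambda>n. g n 0) sums S"
proof -
  have row: "f n sums (S - (\<Sum>m<n. g m 0))" for n
  proof (induction n)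
    case (Suc n)
    have "(\<lambda>k. g n (Suc k) - g n k) sums (0 - g n 0)"
      using mate by (rule telescope_sums)
    with Suc.IH have "(\<lambda>k. f n k + (g n (Suc k) - g n k)) sums (S - (\<Sum>m<n. g m 0) + (0 - g n 0))"
      by (rule sums_add)
    moreover have "f n k + (g n (Suc k) - g n k) = f (Suc n) k" for k using pair[of n k] by simp
    ultimately show ?case by (simp add: algebra_simps)
  qed (use start in simp)
  have "(\<lambda>n. S - (\<Sum>m<n. g m 0)) \<longlonglongrightarrow> 0"
    using vanish by (simp add: sums_unique[OF row, symmetric])
  from tendsto_diff[OF tendsto_const[of S] this] show ?thesis by (simp add: sums_def)
qed

section \<open>The WZ pair\<close>

text \<open>
  The exponential of this is
  \<open>16\<^sup>x \<Gamma>(x+y-1/2)\<^sup>2 \<Gamma>(3x+y) \<Gamma>(x+1)\<^sup>4 / (\<Gamma>(3x+y+1/2)\<^sup>2 \<Gamma>(x+y) \<Gamma>(2x+1))\<close>,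
  which comes from the summand of Watson's \<open>\<^sub>3F\<^sub>2\<close> theorem, divided by the closed form of its sum: the
  parameters move linearly with \<^term>\<open>x\<close>, the summation index is reversed, and the reflection formula makes all
  arguments positive.  In logarithmic form both the functional equation and the derivative are additive.
\<close>

definition wz_log :: "real \<Rightarrow> real \<Rightarrow> real" where
  "wz_log x y = x * ln 16 + 2 * ln_Gamma (x + y - 1/2) + ln_Gamma (3*x + y) + 4 * ln_Gamma (x + 1)
     - 2 * ln_Gamma (3*x + y + 1/2) - ln_Gamma (x + y) - ln_Gamma (2*x + 1)"

definition wz_term :: "real \<Rightarrow> real \<Rightarrow> real" where
  "wz_term x y = exp (wz_log x y)"

text \<open>
  The numerator of the companion certificate is the output of Gosper's algorithm applied in \<^term>\<open>y\<close>
  to the difference of \<open>wz_term\<close> in \<^term>\<open>x\<close>; it has total degree 5 with nonnegative coefficients.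
\<close>

definition wz_num :: "real \<Rightarrow> real \<Rightarrow> real" where
  "wz_num x y =
     (9 + 195*x + 1116*x^2 + 2952*x^3 + 4704*x^4 + 3312*x^5)
   + (59 + 552*x + 2160*x^2 + 5600*x^3 + 5520*x^4) * y
   + (60 + 536*x + 2784*x^2 + 3872*x^3) * y^2
   + (48 + 672*x + 1376*x^2) * y^3
   + (64 + 240*x) * y^4
   + 16 * y^5"

definition wz_den :: "real \<Rightarrow> real \<Rightarrow> real" where
  "wz_den x y = (2*x + 1) * (6*x + 2*y + 1)^2 * (6*x + 2*y + 3)^2"

definition wz_cert :: "real \<Rightarrow> real \<Rightarrow> real" where
  "wz_cert x y = wz_num x y / wz_den x y"

text \<open>
  An open set around the points used later (\<^term>\<open>x\<close> a natural number, \<^term>\<open>y\<close> a positive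
  integer) on which all arguments of the Gamma function are positive; openness is what permits
  differentiation of the identity of the pair.
\<close>

definition wz_dom :: "real \<Rightarrow> real \<Rightarrow> bool" where
  "wz_dom x y \<longleftrightarrow> x > -1/12 \<and> y > 3/4"

lemma ln_Gamma_real_plus1:
  assumes "x > (0::real)"
  shows "ln_Gamma (x + 1) = ln_Gamma x + ln x"
proof -
  have "Gamma (x + 1) = x * Gamma x"
    using assms by (intro Gamma_plus1) (auto elim!: nonpos_Ints_cases)
  thus ?thesis using assms Gamma_real_pos[OF assms] by (simp add: ln_Gamma_real_pos ln_mult_pos)
qed

lemma wz_term_Suc_left:
  assumes "wz_dom x y"
  shows "wz_term (x + 1) y = wz_term x y *
    (16 * (x+y-1/2)^2 * (3*x+y) * (3*x+y+1) * (3*x+y+2) * (x+1)^4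
     / ((3*x+y+1/2)^2 * (3*x+y+3/2)^2 * (3*x+y+5/2)^2 * (x+y) * (2*x+1) * (2*x+2)))" (is "_ = _ * ?r")
proof -
  have pos: "x+y-1/2 > 0" "3*x+y > 0" "3*x+y+1 > 0" "3*x+y+2 > 0" "x+1 > 0" "3*x+y+1/2 > 0"
      "3*x+y+3/2 > 0" "3*x+y+5/2 > 0" "x+y>0" "2*x+1>0" "2*x+2>0"
    using assms by (auto simp: wz_dom_def)
  have lnr: "ln ?r = ln 16 + 2 * ln (x+y-1/2) + ln (3*x+y) + ln (3*x+y+1) + ln (3*x+y+2) + 4 * ln (x+1)
     - 2 * ln (3*x+y+1/2) - 2 * ln (3*x+y+3/2) - 2 * ln (3*x+y+5/2) - ln (x+y) - ln (2*x+1) - ln (2*x+2)"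
    using pos by (simp add: ln_mult ln_div ln_realpow)
  have "wz_log (x+1) y = wz_log x y + ln ?r"
    using ln_Gamma_real_plus1[OF pos(1)] ln_Gamma_real_plus1[OF pos(2)] ln_Gamma_real_plus1[OF pos(3)]
      ln_Gamma_real_plus1[OF pos(4)] ln_Gamma_real_plus1[OF pos(5)] ln_Gamma_real_plus1[OF pos(6)]
      ln_Gamma_real_plus1[OF pos(7)] ln_Gamma_real_plus1[OF pos(8)] ln_Gamma_real_plus1[OF pos(9)]
      ln_Gamma_real_plus1[OF pos(10)] ln_Gamma_real_plus1[OF pos(11)]
    unfolding lnr wz_log_def by (simp add: algebra_simps)
  moreover have "?r > 0" using pos by simp
  ultimately show ?thesis by (simp add: wz_term_def exp_add)
qed

lemma wz_term_Suc_right: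
  assumes "wz_dom x y"
  shows "wz_term x (y + 1) = wz_term x y * ((x+y-1/2)^2 * (3*x+y) / ((3*x+y+1/2)^2 * (x+y)))"
    (is "_ = _ * ?r")
proof -
  have pos: "x+y-1/2 > 0" "3*x+y > 0" "3*x+y+1/2 > 0" "x+y>0"
    using assms by (auto simp: wz_dom_def)
  have lnr: "ln ?r = 2 * ln (x+y-1/2) + ln (3*x+y) - 2 * ln (3*x+y+1/2) - ln (x+y)"
    using pos by (simp add: ln_mult ln_div ln_realpow)
  have "wz_log x (y+1) = wz_log x y + ln ?r"
    using ln_Gamma_real_plus1[OF pos(1)] ln_Gamma_real_plus1[OF pos(2)] ln_Gamma_real_plus1[OF pos(3)]
      ln_Gamma_real_plus1[OF pos(4)]
    unfolding lnr wz_log_def by (simp add: algebra_simps)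
  moreover have "?r > 0" using pos by simp
  ultimately show ?thesis by (simp add: wz_term_def exp_add)
qed

text \<open>
  Dividing the relation of the pair by \<open>wz_term x y\<close> leaves an identity of rational functions.
  In the quantities \<open>u = 6x+2y+1\<close>, \<open>q = x+y\<close>, \<open>w = 2x+1\<close> the denominators
  are products of shifts of these, so clearing them by hand leaves one polynomial identity.
\<close>

lemma wz_cert_identity:
  assumes "wz_dom x y"
  shows "16 * (x+y-1/2)^2 * (3*x+y) * (3*x+y+1) * (3*x+y+2) * (x+1)^4
     / ((3*x+y+1/2)^2 * (3*x+y+3/2)^2 * (3*x+y+5/2)^2 * (x+y) * (2*x+1) * (2*x+2)) - 1
     = (x+y-1/2)^2 * (3*x+y) / ((3*x+y+1/2)^2 * (x+y)) * wz_cert x (y + 1) - wz_cert x y"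
proof -
  define u where "u = 6*x+2*y+1"
  define q where "q = x + y"
  define w where "w = 2*x+1"
  have pos: "u > 0" "q > 0" "w > 0" "w + 1 > 0" using assms by (auto simp: wz_dom_def u_def q_def w_def)
  have e: "3*x+y+1/2 = u/2" "3*x+y+3/2 = (u+2)/2" "3*x+y+5/2 = (u+4)/2" "3*x+y+1 = (u+1)/2"
    "3*x+y+2 = (u+3)/2" "2*x+2 = w+1" "x+1 = (w+1)/2" "x+y-1/2 = (2*q-1)/2"
    and e': "3*x+y = (u-1)/2"
    by (auto simp: u_def w_def q_def field_simps)
  \<comment> \<open>Both sides of the claim, multiplied by \<open>2 q w u\<^sup>2 (u+2)\<^sup>2 (u+4)\<^sup>2\<close>.\<close>
  have poly: "4 * (2*q-1)^2 * (u-1)*(u+1)*(u+3)*(w+1)^3 - 2 * u^2 * (u+2)^2 * (u+4)^2 * q * w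
     = (2*q-1)^2 * (u-1) * wz_num x (y+1) - 2 * (u+4)^2 * q * wz_num x y"
    unfolding u_def q_def w_def wz_num_def by algebra
  have c1: "wz_cert x (y+1) = wz_num x (y+1) / (w * (u+2)^2 * (u+4)^2)"
    by (simp add: wz_cert_def wz_den_def u_def w_def algebra_simps)
  have c0: "wz_cert x y = wz_num x y / (w * u^2 * (u+2)^2)"
    by (simp add: wz_cert_def wz_den_def u_def w_def algebra_simps)
  have "16 * ((2*q-1)/2)^2 * ((u-1)/2) * ((u+1)/2) * ((u+3)/2) * ((w+1)/2)^4
     / ((u/2)^2 * ((u+2)/2)^2 * ((u+4)/2)^2 * q * w * (w+1)) - 1
     = (4 * (2*q-1)^2 * (u-1)*(u+1)*(u+3)*(w+1)^3 - 2 * u^2 * (u+2)^2 * (u+4)^2 * q * w)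
        / (2 * u^2 * (u+2)^2 * (u+4)^2 * q * w)"
    using pos by (simp add: divide_simps) algebra
  also have "\<dots> = ((2*q-1)/2)^2 * ((u-1)/2) / ((u/2)^2 * q) * (wz_num x (y+1) / (w * (u+2)^2 * (u+4)^2))
        - wz_num x y / (w * u^2 * (u+2)^2)"
    unfolding poly using pos by (simp add: divide_simps)
  finally show ?thesis
    unfolding c1 c0 e unfolding e' q_def[symmetric] w_def[symmetric] .
qed

lemma wz_pair:
  assumes "wz_dom x y"
  shows "wz_term (x+1) y - wz_term x y
    = wz_term x (y+1) * wz_cert x (y+1) - wz_term x y * wz_cert x y"
proof -
  have "wz_term (x+1) y - wz_term x y = wz_term x y * (16 * (x+y-1/2)^2 * (3*x+y) * (3*x+y+1) * (3*x+y+2) * (x+1)^4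
     / ((3*x+y+1/2)^2 * (3*x+y+3/2)^2 * (3*x+y+5/2)^2 * (x+y) * (2*x+1) * (2*x+2)) - 1)"
    unfolding wz_term_Suc_left[OF assms] by (simp only: right_diff_distrib mult_1_right)
  also have "\<dots> = wz_term x (y+1) * wz_cert x (y+1) - wz_term x y * wz_cert x y"
    unfolding wz_cert_identity[OF assms] wz_term_Suc_right[OF assms] by (simp only: right_diff_distrib mult.assoc)
  finally show ?thesis .
qed

section \<open>Differentiation of the pair\<close>

definition wz_logderiv :: "real \<Rightarrow> real \<Rightarrow> real \<Rightarrow> real \<Rightarrow> real" where
  "wz_logderiv a b x y =
     a * (ln 16 + 2 * Digamma (x + y - 1/2) + 3 * Digamma (3*x + y) + 4 * Digamma (x + 1)
          - 6 * Digamma (3*x + y + 1/2) - Digamma (x + y) - 2 * Digamma (2*x + 1))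
   + b * (2 * Digamma (x + y - 1/2) + Digamma (3*x + y) - 2 * Digamma (3*x + y + 1/2) - Digamma (x + y))"

definition wz_num_deriv_left :: "real \<Rightarrow> real \<Rightarrow> real" where
  "wz_num_deriv_left x y =
     (195 + 2232*x + 8856*x^2 + 18816*x^3 + 16560*x^4)
   + (552 + 4320*x + 16800*x^2 + 22080*x^3) * y
   + (536 + 5568*x + 11616*x^2) * y^2
   + (672 + 2752*x) * y^3
   + 240 * y^4"

definition wz_num_deriv_right :: "real \<Rightarrow> real \<Rightarrow> real" where
  "wz_num_deriv_right x y =
     (59 + 552*x + 2160*x^2 + 5600*x^3 + 5520*x^4)
   + (120 + 1072*x + 5568*x^2 + 7744*x^3) * y
   + (144 + 2016*x + 4128*x^2) * y^2
   + (256 + 960*x) * y^3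
   + 80 * y^4"

definition wz_cert_deriv :: "real \<Rightarrow> real \<Rightarrow> real \<Rightarrow> real \<Rightarrow> real" where
  "wz_cert_deriv a b x y =
     (a * wz_num_deriv_left x y + b * wz_num_deriv_right x y) / wz_den x y
   - wz_cert x y * (2 * a / (2*x + 1) + 4 * (3*a + b) / (6*x + 2*y + 1) + 4 * (3*a + b) / (6*x + 2*y + 3))"

lemma wz_term_has_derivative:
  assumes "wz_dom x y"
  shows "((\<lambda>t. wz_term (x + a * t) (y + b * t)) has_real_derivative
           wz_term x y * wz_logderiv a b x y) (at 0)"
proof -
  have pos: "x+y-1/2 > 0" "3*x+y > 0" "x+1 > 0" "3*x+y+1/2 > 0" "x+y>0" "2*x+1>0"
    using assms by (auto simp: wz_dom_def)
  have "((\<lambda>t. wz_log (x + a * t) (y + b * t)) has_real_derivative wz_logderiv a b x y) (at 0)"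
    unfolding wz_log_def wz_logderiv_def using pos
    by (auto intro!: derivative_eq_intros simp: algebra_simps)
  thus ?thesis unfolding wz_term_def
    by (auto intro!: derivative_eq_intros)
qed

lemma wz_num_has_derivative:
  "((\<lambda>t. wz_num (x + a * t) (y + b * t)) has_real_derivative
      a * wz_num_deriv_left x y + b * wz_num_deriv_right x y) (at 0)"
  unfolding wz_num_def
  by (rule derivative_eq_intros refl)+ (simp add: wz_num_deriv_left_def wz_num_deriv_right_def algebra_simps power2_eq_square)

lemma wz_den_pos:
  assumes "wz_dom x y" shows "wz_den x y > 0"
  using assms by (auto simp: wz_den_def wz_dom_def)

lemma wz_cert_has_derivative:
  assumes "wz_dom x y"
  shows "((\<lambda>t. wz_cert (x + a * t) (y + b * t)) has_real_derivative wz_cert_deriv a b x y) (at 0)"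
proof -
  have pos: "2*x+1 > 0" "6*x+2*y+1 > 0" "6*x+2*y+3 > 0"
    using assms by (auto simp: wz_dom_def)
  have aux: "2*a * u^2 * v^2 + w * (2 * u * (6*a+2*b)) * v^2 + w * u^2 * (2 * v * (6*a+2*b))
    = w * u^2 * v^2 * (2 * a / w + 4 * (3*a + b) / u + 4 * (3*a + b) / v)"
    if "w > 0" "u > 0" "v > 0" for u v w :: real
    using that by (simp add: field_simps power2_eq_square)
  define D where "D = wz_den x y * (2 * a / (2*x + 1) + 4 * (3*a + b) / (6*x + 2*y + 1) + 4 * (3*a + b) / (6*x + 2*y + 3))"
  have "((\<lambda>t. wz_den (x + a * t) (y + b * t)) has_real_derivative
      2*a * (6*x+2*y+1)^2 * (6*x+2*y+3)^2 + (2*x+1) * (2 * (6*x+2*y+1) * (6*a+2*b)) * (6*x+2*y+3)^2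
       + (2*x+1) * (6*x+2*y+1)^2 * (2 * (6*x+2*y+3) * (6*a+2*b))) (at 0)"
    unfolding wz_den_def by (rule derivative_eq_intros refl)+ (simp add: algebra_simps power2_eq_square)
  moreover have "2*a * (6*x+2*y+1)^2 * (6*x+2*y+3)^2 + (2*x+1) * (2 * (6*x+2*y+1) * (6*a+2*b)) * (6*x+2*y+3)^2
       + (2*x+1) * (6*x+2*y+1)^2 * (2 * (6*x+2*y+3) * (6*a+2*b)) = D"
    unfolding D_def wz_den_def by (rule aux[OF pos])
  ultimately have D: "((\<lambda>t. wz_den (x + a * t) (y + b * t)) has_real_derivative D) (at 0)" by simp
  have "((\<lambda>t. wz_cert (x + a * t) (y + b * t)) has_real_derivative
      ((a * wz_num_deriv_left x y + b * wz_num_deriv_right x y) * wz_den x y - wz_num x y * D) / (wz_den x y * wz_den x y)) (at 0)"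
    unfolding wz_cert_def
    using DERIV_divide[OF wz_num_has_derivative[of x a y b] D] wz_den_pos[OF assms] by simp
  moreover have "((a * wz_num_deriv_left x y + b * wz_num_deriv_right x y) * wz_den x y - wz_num x y * D) / (wz_den x y * wz_den x y)
      = wz_cert_deriv a b x y"
    using wz_den_pos[OF assms] unfolding D_def wz_cert_deriv_def wz_cert_def
    by (simp add: diff_divide_distrib mult.assoc)
  ultimately show ?thesis by simp
qed

text \<open>
  The derivative pair in the direction \<^term>\<open>(a, b)\<close>, plus \<^term>\<open>g\<close> times the pair itself.
  The summand of \<^term>\<open>g\<close> is used to cancel the multiples of \<^term>\<open>ln 2\<close> which the digamma function
  produces at half-integers.
\<close>

definition wz_term_deriv :: "real \<Rightarrow> real \<Rightarrow> real \<Rightarrow> real \<Rightarrow> real \<Rightarrow> real" where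
  "wz_term_deriv g a b x y = wz_term x y * (g + wz_logderiv a b x y)"

definition wz_mate_deriv :: "real \<Rightarrow> real \<Rightarrow> real \<Rightarrow> real \<Rightarrow> real \<Rightarrow> real" where
  "wz_mate_deriv g a b x y = wz_term x y * ((g + wz_logderiv a b x y) * wz_cert x y + wz_cert_deriv a b x y)"

text \<open>
  The relation of the pair holds at all real points near \<^term>\<open>(x, y)\<close>, hence its derivative along a
  line through this point vanishes.  This avoids any rational identity for the differentiated
  certificates.
\<close>

lemma wz_pair_deriv:
  assumes "wz_dom x y"
  shows "wz_term_deriv g a b (x+1) y - wz_term_deriv g a b x y = wz_mate_deriv g a b x (y+1) - wz_mate_deriv g a b x y"
proof -
  have dom: "wz_dom (x+1) y" "wz_dom x (y+1)" using assms by (auto simp: wz_dom_def)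
  \<comment> \<open>The defect of the pair along the line, whose derivative at 0 is computed in two ways.\<close>
  define h where "h = (\<lambda>t. wz_term (x + 1 + a * t) (y + b * t) - wz_term (x + a * t) (y + b * t)
     - (wz_term (x + a * t) (y + 1 + b * t) * wz_cert (x + a * t) (y + 1 + b * t)
        - wz_term (x + a * t) (y + b * t) * wz_cert (x + a * t) (y + b * t)))"
  have "(h has_real_derivative
      wz_term (x+1) y * wz_logderiv a b (x+1) y - wz_term x y * wz_logderiv a b x y
      - ((wz_term x (y+1) * wz_logderiv a b x (y+1) * wz_cert x (y+1) + wz_cert_deriv a b x (y+1) * wz_term x (y+1))
         - (wz_term x y * wz_logderiv a b x y * wz_cert x y + wz_cert_deriv a b x y * wz_term x y))) (at 0)" (is "(_ has_real_derivative ?D) _")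
    unfolding h_def
    by (rule derivative_eq_intros wz_term_has_derivative wz_cert_has_derivative assms dom refl)+ simp
  moreover have "(h has_real_derivative 0) (at 0)"
  proof -
    have "((\<lambda>t. x + a * t) \<longlongrightarrow> x + a * 0) (nhds 0)" "((\<lambda>t. y + b * t) \<longlongrightarrow> y + b * 0) (nhds 0)"
      by (intro tendsto_intros filterlim_ident)+
    hence "\<forall>\<^sub>F t in nhds 0. x + a * t > -1/12" "\<forall>\<^sub>F t in nhds 0. y + b * t > 3/4"
      using assms by (simp_all only: order_tendstoD(1) wz_dom_def mult_zero_right add_0_right)
    hence "\<forall>\<^sub>F t in nhds 0. h t = 0"
    proof eventually_elim
      case (elim t)
      hence "wz_dom (x + a * t) (y + b * t)" by (simp add: wz_dom_def)
      from wz_pair[OF this] show ?case by (simp add: h_def add_ac)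
    qed
    thus ?thesis by (subst DERIV_cong_ev[OF refl _ refl, of _ "\<lambda>_. 0"]) auto
  qed
  ultimately have "?D = 0" by (rule DERIV_unique)
  with wz_pair[OF assms] show ?thesis
    unfolding wz_term_deriv_def wz_mate_deriv_def by algebra
qed

section \<open>Growth estimates and the boundary sum\<close>

text \<open>
  A square root is enough of a bound for logarithmic growth: it leaves \<open>k\<^sup>-\<^sup>2\<close> times a harmonic number
  summable, and \<open>k\<^sup>-\<^sup>1\<close> times a harmonic number null.
\<close>

lemma harm_le_sqrt: "harm n \<le> 2 * sqrt (real n)"
proof (induction n)
  case (Suc n)
  define u v where "u = sqrt (real n)" and "v = sqrt (real (Suc n))"
  have uv: "0 \<le> u" "u \<le> v" "v \<ge> 1" "v^2 = u^2 + 1" by (auto simp: u_def v_def)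
  have "1 = (v - u) * (v + u)" using uv(4) by (simp add: algebra_simps power2_eq_square)
  also have "\<dots> \<le> (v - u) * (2 * v^2)"
  proof (rule mult_left_mono)
    have "v * 1 \<le> v * v" using uv by (intro mult_left_mono) auto
    thus "v + u \<le> 2 * v^2" using uv(2) by (simp add: power2_eq_square)
  qed (use uv in simp)
  finally have "inverse (v^2) \<le> 2 * (v - u)" using uv(3) by (simp add: field_simps)
  moreover have "v^2 = real (Suc n)" by (simp add: v_def)
  ultimately show ?case using Suc.IH by (simp add: harm_Suc u_def v_def)
qed (simp add: harm_def)

text \<open>
  Monotonicity reduces the claim to \<^term>\<open>Digamma (1/2)\<close> from below and to harmonic numbers from above.
\<close>

lemma abs_Digamma_le_sqrt:
  assumes "x \<ge> (1/2::real)"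
  shows "\<bar>Digamma x\<bar> \<le> 2 * sqrt (x + 1)"
proof -
  define m where "m = nat \<lceil>x\<rceil>"
  have m: "x \<le> real m" "real m \<le> x + 1" using assms by (auto simp: m_def)
  have "- 2 \<le> Digamma (1/2::real)"
    using euler_mascheroni_less_13_over_22 ln2_le_25_over_36 by (simp add: Digamma_one_half)
  also have "\<dots> \<le> Digamma x" using assms by (intro Digamma_real_mono) auto
  finally have lower: "- 2 \<le> Digamma x" .
  have "Digamma x \<le> Digamma (real (Suc m))" using assms m by (intro Digamma_real_mono) auto
  also have "\<dots> = harm m - euler_mascheroni" by (rule Digamma_of_nat)
  also have "\<dots> \<le> 2 * sqrt (real m)" using harm_le_sqrt[of m] euler_mascheroni_pos by simp
  also have "\<dots> \<le> 2 * sqrt (x + 1)" using m by simp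
  finally have upper: "Digamma x \<le> 2 * sqrt (x + 1)" .
  have "1 \<le> sqrt (x + 1)" using assms by simp
  with lower upper show ?thesis by linarith
qed

lemma wz_logderiv_bound:
  obtains C where "C \<ge> 0"
    "\<And>n k. \<bar>g + wz_logderiv a b (real n) (real k + 1)\<bar> \<le> C * (sqrt (real n + 1) * sqrt (real k + 1))"
proof
  let ?C = "\<bar>g\<bar> + \<bar>a\<bar> * (ln 16 + 72) + \<bar>b\<bar> * 24"
  show "?C \<ge> 0" by simp
  fix n k
  define S where "S = sqrt (real n + 1) * sqrt (real k + 1)"
  have "1 * 1 \<le> S" unfolding S_def by (rule mult_mono) auto
  hence S1: "S \<ge> 1" by simp
  have psi: "\<bar>Digamma z\<bar> \<le> 4 * S" if "z \<ge> 1/2" "z \<le> 3 * real n + real k + 3/2" for z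
  proof -
    have "0 \<le> real n * real k" by simp
    hence "z + 1 \<le> 4 * ((real n + 1) * (real k + 1))"
      unfolding distrib_left distrib_right using that(2) by linarith
    hence "sqrt (z + 1) \<le> sqrt (4 * ((real n + 1) * (real k + 1)))" by (rule real_sqrt_le_mono)
    also have "\<dots> = 2 * S" by (simp add: S_def real_sqrt_mult)
    finally show ?thesis using abs_Digamma_le_sqrt[OF that(1)] by simp
  qed
  have A: "\<bar>ln 16 + 2 * d1 + 3 * d2 + 4 * d3 - 6 * d4 - d5 - 2 * d6\<bar> \<le> (ln 16 + 72) * S"
    if "\<bar>d1\<bar> \<le> 4 * S" "\<bar>d2\<bar> \<le> 4 * S" "\<bar>d3\<bar> \<le> 4 * S" "\<bar>d4\<bar> \<le> 4 * S" "\<bar>d5\<bar> \<le> 4 * S" "\<bar>d6\<bar> \<le> 4 * S"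
    for d1 d2 d3 d4 d5 d6 :: real
  proof -
    have "ln 16 * 1 \<le> ln 16 * S" using S1 by (intro mult_left_mono) auto
    moreover have "0 \<le> ln (16::real)" by simp
    ultimately show ?thesis using that[THEN abs_le_D1] that[THEN abs_le_D2]
      unfolding distrib_right by (intro abs_leI) linarith+
  qed
  have B: "\<bar>2 * d1 + d2 - 2 * d4 - d5\<bar> \<le> 24 * S"
    if "\<bar>d1\<bar> \<le> 4 * S" "\<bar>d2\<bar> \<le> 4 * S" "\<bar>d4\<bar> \<le> 4 * S" "\<bar>d5\<bar> \<le> 4 * S"
    for d1 d2 d4 d5 :: real
    using that[THEN abs_le_D1] that[THEN abs_le_D2] by (intro abs_leI) linarith+
  have tri: "\<bar>r + (s + t)\<bar> \<le> r' + s' + t'" if "\<bar>r\<bar> \<le> r'" "\<bar>s\<bar> \<le> s'" "\<bar>t\<bar> \<le> t'" for r s t r' s' t' :: real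
    using that by linarith
  let ?x = "real n" and ?y = "real k + 1"
  let ?A = "ln 16 + 2 * Digamma (?x + ?y - 1/2) + 3 * Digamma (3*?x + ?y) + 4 * Digamma (?x + 1)
          - 6 * Digamma (3*?x + ?y + 1/2) - Digamma (?x + ?y) - 2 * Digamma (2*?x + 1)"
  let ?B = "2 * Digamma (?x + ?y - 1/2) + Digamma (3*?x + ?y) - 2 * Digamma (3*?x + ?y + 1/2) - Digamma (?x + ?y)"
  have "\<bar>?A\<bar> \<le> (ln 16 + 72) * S" by (rule A; rule psi; simp)
  hence A': "\<bar>a * ?A\<bar> \<le> \<bar>a\<bar> * ((ln 16 + 72) * S)" by (simp only: abs_mult mult_left_mono abs_ge_zero)
  have "\<bar>?B\<bar> \<le> 24 * S" by (rule B; rule psi; simp)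
  hence B': "\<bar>b * ?B\<bar> \<le> \<bar>b\<bar> * (24 * S)" by (simp only: abs_mult mult_left_mono abs_ge_zero)
  have "\<bar>g\<bar> * 1 \<le> \<bar>g\<bar> * S" using S1 by (intro mult_left_mono) auto
  hence g: "\<bar>g\<bar> \<le> \<bar>g\<bar> * S" by simp
  from tri[OF g A' B'] have "\<bar>g + wz_logderiv a b ?x ?y\<bar> \<le> \<bar>g\<bar> * S + \<bar>a\<bar> * ((ln 16 + 72) * S) + \<bar>b\<bar> * (24 * S)"
    unfolding wz_logderiv_def .
  also have "\<dots> = ?C * S" by (simp add: algebra_simps)
  finally show "\<bar>g + wz_logderiv a b ?x ?y\<bar> \<le> ?C * (sqrt (real n + 1) * sqrt (real k + 1))"
    unfolding S_def .
qed

lemma wz_term_0: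
  assumes "y > 1/2" shows "wz_term 0 y = 1 / (y - 1/2)^2"
proof -
  have "ln_Gamma (y + 1/2) = ln_Gamma (y - 1/2) + ln (y - 1/2)"
    using ln_Gamma_real_plus1[of "y - 1/2"] assms by (simp add: add_ac)
  hence "wz_log 0 y = - (2 * ln (y - 1/2))"
    by (simp add: wz_log_def ln_Gamma_real_pos)
  also have "\<dots> = ln (1 / (y - 1/2)^2)" using assms by (simp add: ln_div ln_realpow)
  finally show ?thesis using assms by (simp add: wz_term_def)
qed

text \<open>
  With \<open>m = x + y - 1/2\<close> the factors \<open>3x+y+3/2\<close> and \<open>3x+y+5/2\<close> are \<open>2x+2+m\<close> and \<open>2x+3+m\<close>.
  The inequality of arithmetic and geometric means bounds their product below by \<open>8(x+1)m\<close>, which removes \<open>m\<close>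
  from the ratio up to a factor that is monotone in \<open>m\<close>.  The constant \<open>2/3\<close> is what this
  crude argument gives at \<open>x = 0\<close>, \<open>y = 1\<close>; any constant below 1 would do.
\<close>

lemma wz_ratio_le:
  assumes "x \<ge> 0" "y \<ge> (1::real)"
  shows "16 * (x+y-1/2)^2 * (3*x+y) * (3*x+y+1) * (3*x+y+2) * (x+1)^4
     / ((3*x+y+1/2)^2 * (3*x+y+3/2)^2 * (3*x+y+5/2)^2 * (x+y) * (2*x+1) * (2*x+2)) \<le> 2/3"
proof -
  define m where "m = x + y - 1/2"
  define u v w where "u = 3*x+y+1/2" and "v = 3*x+y+3/2" and "w = 3*x+y+5/2"
  have pos: "m > 0" "u > 0" "v > 0" "w > 0" "x + y > 0" using assms by (auto simp: m_def u_def v_def w_def)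
  have "m * ((3*x+y) * (3*x+y+1) * (3*x+y+2)) \<le> (x+y) * (u * v * w)"
    by (intro mult_mono) (use assms in \<open>auto simp: m_def u_def v_def w_def\<close>)
  hence "16 * m * (x+1)^4 * (m * ((3*x+y) * (3*x+y+1) * (3*x+y+2)))
       \<le> 16 * m * (x+1)^4 * ((x+y) * (u * v * w))"
    using pos assms by (intro mult_left_mono) auto
  also have "24 * m * (x+1)^3 \<le> 2 * (2*x+1) * (u * v * w)"
  proof -
    have amgm: "8 * (x+1) * m \<le> v * w"
    proof -
      have "v * w = (2*x+2+m) * (2*x+3+m)" by (simp add: v_def w_def m_def algebra_simps)
      also have "\<dots> - 8 * (x+1) * m = (2*x+2-m)^2 + (2*x+2+m)" by (simp add: power2_eq_square algebra_simps)
      also have "\<dots> \<ge> 0" using assms pos(1) by simp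
      finally show ?thesis by simp
    qed
    have "3 * (x+1)^2 \<le> 2 * (2*x+1) * (2*x+3/2)" using assms(1) by (simp add: power2_eq_square algebra_simps)
    also have "\<dots> \<le> 2 * (2*x+1) * u" using assms by (intro mult_left_mono) (auto simp: u_def)
    finally have "3 * (x+1)^2 * (8 * (x+1) * m) \<le> 2 * (2*x+1) * u * (v * w)"
      using amgm pos assms by (rule_tac mult_mono) auto
    thus ?thesis by (simp add: power2_eq_square power3_eq_cube algebra_simps)
  qed
  hence "16 * m * (x+1)^4 * ((x+y) * (u * v * w)) \<le> 2/3 * (2 * (x+1) * (2*x+1)) * ((x+y) * (u * v * w) * (u * v * w))"
  proof -
    assume *: "24 * m * (x+1)^3 \<le> 2 * (2*x+1) * (u * v * w)"
    have "16 * m * (x+1)^4 * ((x+y) * (u * v * w)) = (2/3 * (x+1) * ((x+y) * (u * v * w))) * (24 * m * (x+1)^3)"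
      by (simp add: power3_eq_cube power4_eq_xxxx)
    also have "\<dots> \<le> (2/3 * (x+1) * ((x+y) * (u * v * w))) * (2 * (2*x+1) * (u * v * w))"
      using * pos assms by (intro mult_left_mono) auto
    finally show ?thesis by (simp only: mult_ac)
  qed
  finally have "16 * m * (x+1)^4 * (m * ((3*x+y) * (3*x+y+1) * (3*x+y+2)))
      \<le> 2/3 * (2 * (x+1) * (2*x+1) * ((x+y) * (u * v * w) * (u * v * w)))" by (simp only: mult.assoc)
  also have "16 * m * (x+1)^4 * (m * ((3*x+y) * (3*x+y+1) * (3*x+y+2)))
      = 16 * m^2 * (3*x+y) * (3*x+y+1) * (3*x+y+2) * (x+1)^4" by algebra
  also have "2 * (x+1) * (2*x+1) * ((x+y) * (u * v * w) * (u * v * w))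
      = u^2 * v^2 * w^2 * (x+y) * (2*x+1) * (2*x+2)" by algebra
  finally have "16 * m^2 * (3*x+y) * (3*x+y+1) * (3*x+y+2) * (x+1)^4
      \<le> 2/3 * (u^2 * v^2 * w^2 * (x+y) * (2*x+1) * (2*x+2))" .
  moreover have "u^2 * v^2 * w^2 * (x+y) * (2*x+1) * (2*x+2) > 0" using pos assms by simp
  ultimately show ?thesis unfolding m_def u_def v_def w_def by (simp only: pos_divide_le_eq)
qed

lemma wz_term_le:
  "wz_term (real n) (real k + 1) \<le> (2/3)^n / (real k + 1/2)^2"
proof (induction n)
  case 0
  show ?case using wz_term_0[of "real k + 1"] by (simp add: add_divide_distrib algebra_simps)
next
  case (Suc n)
  have "wz_dom (real n) (real k + 1)" by (simp add: wz_dom_def)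
  note step = wz_term_Suc_left[OF this]
  have "wz_term (real n + 1) (real k + 1) \<le> wz_term (real n) (real k + 1) * (2/3)"
    unfolding step by (intro mult_left_mono wz_ratio_le) (auto simp: wz_term_def)
  also have "\<dots> \<le> (2/3)^n / (real k + 1/2)^2 * (2/3)" using Suc.IH by simp
  finally show ?case by (simp add: add_ac)
qed

text \<open>
  The numerator has degree 5 in \<^term>\<open>y\<close> and the denominator is at least \<^term>\<open>y^4\<close>, so for fixed \<^term>\<open>x\<close>
  the certificate and its derivative grow at most linearly.
\<close>

lemma wz_cert_bound:
  assumes "x \<ge> 0" "y \<ge> 1"
  shows "wz_cert x y \<ge> 0" "wz_cert x y \<le> wz_num x 1 * y"
    "\<bar>wz_cert_deriv a b x y\<bar> \<le> (\<bar>a\<bar> * wz_num_deriv_left x 1 + \<bar>b\<bar> * wz_num_deriv_right x 1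
        + wz_num x 1 * (2 * \<bar>a\<bar> + 8 * \<bar>3*a+b\<bar>)) * y"
proof -
  have pw: "y \<le> y^5" "y^2 \<le> y^5" "y^3 \<le> y^5" "y^4 \<le> y^5" "1 \<le> y^5"
    using assms(2) power_increasing[of 1 5 y] power_increasing[of 2 5 y] power_increasing[of 3 5 y]
     power_increasing[of 4 5 y] power_increasing[of 0 5 y] by auto
  have num0: "wz_num x y \<ge> 0" "wz_num_deriv_left x y \<ge> 0" "wz_num_deriv_right x y \<ge> 0"
    using assms unfolding wz_num_def wz_num_deriv_left_def wz_num_deriv_right_def by auto
  have mono: "c0 + c1 * y + c2 * y^2 + c3 * y^3 + c4 * y^4 + c5 * y^5 \<le> (c0 + c1 + c2 + c3 + c4 + c5) * y^5"
    if "c0 \<ge> 0" "c1 \<ge> 0" "c2 \<ge> 0" "c3 \<ge> 0" "c4 \<ge> 0" "c5 \<ge> 0" for c0 c1 c2 c3 c4 c5 :: real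
    using mult_left_mono[OF pw(1) that(2)] mult_left_mono[OF pw(2) that(3)] mult_left_mono[OF pw(3) that(4)]
      mult_left_mono[OF pw(4) that(5)] mult_left_mono[OF pw(5) that(1)] by (simp add: algebra_simps)
  have n0: "wz_num x y \<le> wz_num x 1 * y^5"
    using mono[of "9 + 195*x + 1116*x^2 + 2952*x^3 + 4704*x^4 + 3312*x^5" "59 + 552*x + 2160*x^2 + 5600*x^3 + 5520*x^4"
      "60 + 536*x + 2784*x^2 + 3872*x^3" "48 + 672*x + 1376*x^2" "64 + 240*x" 16] assms
    unfolding wz_num_def by simp
  have n1: "wz_num_deriv_left x y \<le> wz_num_deriv_left x 1 * y^5"
    using mono[of "195 + 2232*x + 8856*x^2 + 18816*x^3 + 16560*x^4" "552 + 4320*x + 16800*x^2 + 22080*x^3"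
      "536 + 5568*x + 11616*x^2" "672 + 2752*x" 240 0] assms
    unfolding wz_num_deriv_left_def by simp
  have n2: "wz_num_deriv_right x y \<le> wz_num_deriv_right x 1 * y^5"
    using mono[of "59 + 552*x + 2160*x^2 + 5600*x^3 + 5520*x^4" "120 + 1072*x + 5568*x^2 + 7744*x^3"
      "144 + 2016*x + 4128*x^2" "256 + 960*x" 80 0] assms
    unfolding wz_num_deriv_right_def by simp
  have "1 * y^2 * y^2 \<le> wz_den x y" unfolding wz_den_def
    using assms by (intro mult_mono power_mono) auto
  hence den: "wz_den x y \<ge> y^4" by (simp add: power2_eq_square power4_eq_xxxx mult.assoc)
  have y4: "y^4 > 0" using assms by simp
  hence den0: "wz_den x y > 0" using den by linarith
  have quot: "z / wz_den x y \<le> c * y" if "z \<ge> 0" "z \<le> c * y^5" for z c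
  proof -
    have "z / wz_den x y \<le> z / y^4" by (rule divide_left_mono[OF den that(1) mult_pos_pos[OF den0 y4]])
    also have "\<dots> \<le> c * y^5 / y^4" using that y4 by (intro divide_right_mono) auto
    also have "\<dots> = c * y" using y4 by (simp add: field_simps eval_nat_numeral)
    finally show ?thesis .
  qed
  show c0: "wz_cert x y \<ge> 0" using num0 den0 unfolding wz_cert_def by (intro divide_nonneg_pos) auto
  show c1: "wz_cert x y \<le> wz_num x 1 * y" unfolding wz_cert_def by (rule quot[OF num0(1) n0])
  have frac: "\<bar>c / d\<bar> \<le> \<bar>c\<bar>" if "d \<ge> 1" for c d :: real
    using that by (simp add: abs_divide divide_le_eq mult_left_mono mult_le_cancel_left1)
  have f: "\<bar>2 * a / (2*x + 1)\<bar> \<le> \<bar>2 * a\<bar>" "\<bar>4 * (3*a + b) / (6*x + 2*y + 1)\<bar> \<le> \<bar>4 * (3*a+b)\<bar>"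
     "\<bar>4 * (3*a + b) / (6*x + 2*y + 3)\<bar> \<le> \<bar>4 * (3*a+b)\<bar>"
    by (rule frac; use assms in simp)+
  have e: "\<bar>2 * a\<bar> = 2 * \<bar>a\<bar>" "\<bar>4 * (3*a+b)\<bar> = 4 * \<bar>3*a+b\<bar>" by (simp_all only: abs_mult abs_numeral)
  have "\<bar>2 * a / (2*x + 1) + 4 * (3*a + b) / (6*x + 2*y + 1) + 4 * (3*a + b) / (6*x + 2*y + 3)\<bar>
     \<le> 2 * \<bar>a\<bar> + 8 * \<bar>3*a+b\<bar>" using f unfolding e by linarith
  hence r: "\<bar>wz_cert x y * (2 * a / (2*x + 1) + 4 * (3*a + b) / (6*x + 2*y + 1) + 4 * (3*a + b) / (6*x + 2*y + 3))\<bar>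
      \<le> wz_num x 1 * y * (2 * \<bar>a\<bar> + 8 * \<bar>3*a+b\<bar>)"
    unfolding abs_mult using c0 c1 by (intro mult_mono) auto
  have q: "\<bar>(a * wz_num_deriv_left x y + b * wz_num_deriv_right x y) / wz_den x y\<bar>
      \<le> (\<bar>a\<bar> * wz_num_deriv_left x 1 + \<bar>b\<bar> * wz_num_deriv_right x 1) * y"
  proof -
    have "\<bar>a * wz_num_deriv_left x y + b * wz_num_deriv_right x y\<bar>
        \<le> \<bar>a\<bar> * wz_num_deriv_left x y + \<bar>b\<bar> * wz_num_deriv_right x y"
      using abs_triangle_ineq[of "a * wz_num_deriv_left x y" "b * wz_num_deriv_right x y"] num0 by (simp add: abs_mult)
    also have "\<dots> \<le> \<bar>a\<bar> * (wz_num_deriv_left x 1 * y^5) + \<bar>b\<bar> * (wz_num_deriv_right x 1 * y^5)"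
      using n1 n2 by (intro add_mono mult_left_mono) auto
    finally have "\<bar>a * wz_num_deriv_left x y + b * wz_num_deriv_right x y\<bar>
       \<le> (\<bar>a\<bar> * wz_num_deriv_left x 1 + \<bar>b\<bar> * wz_num_deriv_right x 1) * y^5" by (simp add: algebra_simps)
    from quot[OF abs_ge_zero this] show ?thesis using den0 by (simp add: abs_divide)
  qed
  have tri: "\<bar>r - s\<bar> \<le> r' + s'" if "\<bar>r\<bar> \<le> r'" "\<bar>s\<bar> \<le> s'" for r s r' s' :: real
    using that by linarith
  have "\<bar>wz_cert_deriv a b x y\<bar> \<le> (\<bar>a\<bar> * wz_num_deriv_left x 1 + \<bar>b\<bar> * wz_num_deriv_right x 1) * y
        + wz_num x 1 * y * (2 * \<bar>a\<bar> + 8 * \<bar>3*a+b\<bar>)"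
    using tri[OF q r] unfolding wz_cert_deriv_def .
  also have "\<dots> = (\<bar>a\<bar> * wz_num_deriv_left x 1 + \<bar>b\<bar> * wz_num_deriv_right x 1
        + wz_num x 1 * (2 * \<bar>a\<bar> + 8 * \<bar>3*a+b\<bar>)) * y" by (simp only: distrib_left mult_ac)
  finally show "\<bar>wz_cert_deriv a b x y\<bar> \<le> (\<bar>a\<bar> * wz_num_deriv_left x 1 + \<bar>b\<bar> * wz_num_deriv_right x 1
        + wz_num x 1 * (2 * \<bar>a\<bar> + 8 * \<bar>3*a+b\<bar>)) * y" .
qed

text \<open>
  The row sums vanish in the limit because of the geometric factor \<^term>\<open>(2/3)^n\<close>, and the companion vanishes for
  \<open>k \<rightarrow> \<infinity>\<close> because it is at most of the order \<open>k\<^sup>-\<^sup>2 \<sqdot> k \<sqdot> \<surd>k\<close>.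
\<close>

lemma sum_wz_mate_deriv:
  assumes start: "(\<lambda>k. wz_term_deriv g a b 0 (real k + 1)) sums S"
  shows "(\<lambda>n. wz_mate_deriv g a b (real n) 1) sums S"
proof -
  obtain C where C: "C \<ge> 0"
    "\<And>n k. \<bar>g + wz_logderiv a b (real n) (real k + 1)\<bar> \<le> C * (sqrt (real n + 1) * sqrt (real k + 1))"
    using wz_logderiv_bound[of g a b] by blast
  define f where "f = (\<lambda>n k. wz_term_deriv g a b (real n) (real k + 1))"
  define h where "h = (\<lambda>n k. wz_mate_deriv g a b (real n) (real k + 1))"
  have pair: "f (Suc n) k - f n k = h n (Suc k) - h n k" for n k
    using wz_pair_deriv[of "real n" "real k + 1" g a b] by (simp add: f_def h_def wz_dom_def add_ac)
  have mate: "h n \<longlonglongrightarrow> 0" for n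
  proof (rule Lim_null_comparison)
    define A where "A = C * sqrt (real n + 1) * wz_num (real n) 1"
    define B where "B = \<bar>a\<bar> * wz_num_deriv_left (real n) 1 + \<bar>b\<bar> * wz_num_deriv_right (real n) 1
        + wz_num (real n) 1 * (2 * \<bar>a\<bar> + 8 * \<bar>3*a+b\<bar>)"
    have "\<bar>h n k\<bar> \<le> 1 / (real k + 1/2)^2 * (A * (sqrt (real k + 1) * (real k + 1)) + B * (real k + 1))" for k
    proof -
      have "(2/3)^n / (real k + 1/2)^2 \<le> 1 / (real k + 1/2)^2"
        by (intro divide_right_mono power_le_one) auto
      hence t: "wz_term (real n) (real k + 1) \<le> 1 / (real k + 1/2)^2" using wz_term_le[of n k] by linarith
      have "\<bar>(g + wz_logderiv a b (real n) (real k + 1)) * wz_cert (real n) (real k + 1)\<bar>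
         \<le> C * (sqrt (real n + 1) * sqrt (real k + 1)) * (wz_num (real n) 1 * (real k + 1))"
        unfolding abs_mult using C wz_cert_bound[of "real n" "real k + 1"] by (intro mult_mono) auto
      hence "\<bar>(g + wz_logderiv a b (real n) (real k + 1)) * wz_cert (real n) (real k + 1)\<bar>
         \<le> A * (sqrt (real k + 1) * (real k + 1))" by (simp add: A_def mult_ac)
      moreover have "\<bar>wz_cert_deriv a b (real n) (real k + 1)\<bar> \<le> B * (real k + 1)"
        unfolding B_def by (rule wz_cert_bound) auto
      ultimately have "\<bar>(g + wz_logderiv a b (real n) (real k + 1)) * wz_cert (real n) (real k + 1) + wz_cert_deriv a b (real n) (real k + 1)\<bar>
         \<le> A * (sqrt (real k + 1) * (real k + 1)) + B * (real k + 1)" by linarith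
      thus ?thesis unfolding h_def wz_mate_deriv_def abs_mult using t
        by (intro mult_mono) (auto simp: wz_term_def)
    qed
    thus "\<forall>\<^sub>F k in sequentially. norm (h n k) \<le>
       1 / (real k + 1/2)^2 * (A * (sqrt (real k + 1) * (real k + 1)) + B * (real k + 1))" by simp
    have "(\<lambda>k. 1 / (real k + 1/2)^2 * (sqrt (real k + 1) * (real k + 1))) \<longlonglongrightarrow> 0"
      "(\<lambda>k. 1 / (real k + 1/2)^2 * (real k + 1)) \<longlonglongrightarrow> 0" by real_asymp+
    from tendsto_add[OF tendsto_mult_left[OF this(1), of A] tendsto_mult_left[OF this(2), of B]]
    show "(\<lambda>k. 1 / (real k + 1/2)^2 * (A * (sqrt (real k + 1) * (real k + 1)) + B * (real k + 1))) \<longlonglongrightarrow> 0"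
      by (simp only: distrib_left mult.left_commute add_0_right mult_zero_right)
  qed
  define e where "e = (\<lambda>k. sqrt (real k + 1) / (real k + 1/2)^2)"
  have e: "summable e"
  proof (rule summable_comparison_test_bigo)
    show "summable (\<lambda>k. norm (real k powr (-3/2)))" by (simp add: summable_real_powr_iff)
    show "e \<in> O(\<lambda>k. real k powr (-3/2))" unfolding e_def by real_asymp
  qed
  have fb: "norm (f n k) \<le> ((2/3)^n * C * sqrt (real n + 1)) * e k" for n k
  proof -
    have "norm (f n k) \<le> (2/3)^n / (real k + 1/2)^2 * (C * (sqrt (real n + 1) * sqrt (real k + 1)))"
      unfolding f_def wz_term_deriv_def real_norm_def abs_mult using C wz_term_le[of n k]
      by (intro mult_mono) (auto simp: wz_term_def)
    thus ?thesis by (simp add: e_def mult_ac)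
  qed
  have vanish: "(\<lambda>n. \<Sum>k. f n k) \<longlonglongrightarrow> 0"
  proof (rule Lim_null_comparison)
    have "norm (\<Sum>k. f n k) \<le> (2/3)^n * sqrt (real n + 1) * (C * suminf e)" for n
    proof -
      have "norm (\<Sum>k. f n k) \<le> (\<Sum>k. ((2/3)^n * C * sqrt (real n + 1)) * e k)"
        by (rule norm_suminf_le[OF fb[of n] summable_mult[OF e]])
      also have "\<dots> = ((2/3)^n * C * sqrt (real n + 1)) * suminf e" by (rule suminf_mult[OF e])
      finally show ?thesis by (simp only: mult_ac)
    qed
    thus "\<forall>\<^sub>F n in sequentially. norm (\<Sum>k. f n k) \<le> (2/3)^n * sqrt (real n + 1) * (C * suminf e)" by simp
    have "(\<lambda>n. (2/3)^n * sqrt (real n + 1)) \<longlonglongrightarrow> 0" by real_asymp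
    from tendsto_mult_right[OF this, of "C * suminf e"]
    show "(\<lambda>n. (2/3)^n * sqrt (real n + 1) * (C * suminf e)) \<longlonglongrightarrow> 0" by simp
  qed
  have "f 0 sums S" using start by (simp add: f_def)
  from wz_pair_sums[of f h, OF pair mate vanish this] show ?thesis by (simp add: h_def)
qed

section \<open>An Euler sum from the alternating Tornheim series\<close>

text \<open>
  The summand of the simplest Tornheim double series; with the convention \<open>1 / 0 = 0\<close> it vanishes
  on the axes, so that sums may run over all pairs of natural numbers.
\<close>

definition tornheim :: "nat \<times> nat \<Rightarrow> real" where
  "tornheim = (\<lambda>(a, b). 1 / (real a * real b * (real a + real b)))"

definition odd_harm :: "nat \<Rightarrow> real" where
  "odd_harm n = (\<Sum>i<n. 1 / (2 * real i + 1))"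

lemma harm_double: "harm (2 * n) = odd_harm n + harm n / (2::real)"
  by (induction n) (simp_all add: harm_Suc odd_harm_def harm_def field_simps)

lemma sums_harm: "(\<lambda>b. 1 / real (Suc b) - 1 / real (a + Suc b)) sums harm a"
proof (induction a)
  case (Suc a)
  have "(\<lambda>b. 1 / real (a + Suc b)) \<longlonglongrightarrow> 0" by real_asymp
  from telescope_sums'[OF this] have "(\<lambda>b. 1 / real (a + Suc b) - 1 / real (a + Suc (Suc b))) sums (1 / real (Suc a))"
    by simp
  from sums_add[OF Suc.IH this] show ?case by (simp add: harm_Suc inverse_eq_divide)
qed (simp add: harm_def)

lemma tornheim_row: "((\<lambda>b. tornheim (a, b)) has_sum harm a / real a ^ 2) UNIV"
proof (cases "a = 0")
  case False
  have "(\<lambda>b. 1 / real a ^ 2 * (1 / real (Suc b) - 1 / real (a + Suc b))) sums (1 / real a ^ 2 * harm a)"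
    by (intro sums_mult sums_harm)
  moreover have "1 / real a ^ 2 * (1 / real (Suc b) - 1 / real (a + Suc b)) = tornheim (a, Suc b)" for b
  proof -
    have "1 / x ^ 2 * (1 / y - 1 / (x + y)) = 1 / (x * y * (x + y))" if "x > 0" "y > 0" for x y :: real
      using that by (simp add: divide_simps power2_eq_square)
    from this[of "real a" "real (Suc b)"] False show ?thesis by (simp add: tornheim_def add_ac)
  qed
  ultimately have "(\<lambda>b. tornheim (a, Suc b)) sums (harm a / real a ^ 2)" by simp
  hence "(\<lambda>b. tornheim (a, b)) sums (harm a / real a ^ 2)"
    by (subst (asm) sums_Suc_iff) (simp add: tornheim_def)
  thus ?thesis by (rule sums_nonneg_imp_has_sum) (simp add: tornheim_def)
qed (simp add: tornheim_def)

text \<open>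
  Since \<^term>\<open>2*j+1\<close> is odd, the sign \<open>(-1)\<^sup>b\<close> is opposite to \<open>(-1)\<^sup>a\<^sup>+\<^sup>b\<close>.  After a partial fraction
  decomposition both parts are therefore, up to sign, tails of the alternating harmonic series, which accounts for
  the term \<^term>\<open>2 * ln 2\<close>.
\<close>

lemma tornheim_row_alternating:
  "((\<lambda>b. (-1)^b * tornheim (2*j+1, b)) has_sum
     (odd_harm (j+1) - harm j / 2 - 2 * ln 2) / real (2*j+1) ^ 2) UNIV"
proof (rule norm_summable_imp_has_sum)
  let ?a = "2*j+1"
  have "summable (\<lambda>b. tornheim (?a, b))"
    by (rule sums_summable, rule has_sum_imp_sums, rule tornheim_row)
  thus "summable (\<lambda>b. norm ((-1)^b * tornheim (?a, b)))"
    by (simp add: abs_mult power_abs tornheim_def)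
  have part: "(\<Sum>k<?a. (-1)^k / real (Suc k)) = odd_harm (j+1) - harm j / 2"
  proof (induction j)
    case (Suc j)
    have "(\<Sum>k<2 * Suc j + 1. (-1)^k / real (Suc k))
        = (\<Sum>k<2*j+1. (-1)^k / real (Suc k)) - 1 / (2 * real (Suc j)) + 1 / (2 * real (Suc j) + 1)"
      by (simp add: add_ac)
    also have "\<dots> = odd_harm (Suc j + 1) - harm (Suc j) / 2"
      unfolding Suc.IH by (simp add: odd_harm_def harm_Suc inverse_eq_divide add_divide_distrib)
    finally show ?case .
  qed (simp add: odd_harm_def harm_def)
  have "(\<lambda>b. (-1)^(b + ?a) / real (Suc (b + ?a))) sums (ln 2 - (\<Sum>k<?a. (-1)^k / real (Suc k)))"
    using alternating_harmonic_series_sums by (rule sums_split_initial_segment)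
  from sums_add[OF sums_minus[OF this] sums_minus[OF alternating_harmonic_series_sums]]
  have "(\<lambda>b. (-1)^b * (1 / real (?a + Suc b) - 1 / real (Suc b))) sums (odd_harm (j+1) - harm j / 2 - 2 * ln 2)"
    unfolding part by (simp add: power_add algebra_simps)
  from sums_mult[OF this, of "1 / real ?a ^ 2"]
  have row: "(\<lambda>b. 1 / real ?a ^ 2 * ((-1)^b * (1 / real (?a + Suc b) - 1 / real (Suc b)))) sums
     ((odd_harm (j+1) - harm j / 2 - 2 * ln 2) / real ?a ^ 2)" by simp
  have eq: "1 / real ?a ^ 2 * ((-1)^b * (1 / real (?a + Suc b) - 1 / real (Suc b))) = (-1)^Suc b * tornheim (?a, Suc b)" for b
  proof -
    have "1 / x ^ 2 * (s * (1 / (x + y) - 1 / y)) = - s * (1 / (x * y * (x + y)))" if "x > 0" "y > 0" for x y s :: real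
      using that by (simp add: divide_simps power2_eq_square)
    from this[of "real ?a" "real (Suc b)" "(-1)^b"] show ?thesis unfolding tornheim_def by simp
  qed
  from row[unfolded eq] show "(\<lambda>b. (-1)^b * tornheim (?a, b)) sums
     ((odd_harm (j+1) - harm j / 2 - 2 * ln 2) / real ?a ^ 2)"
    by (subst (asm) sums_Suc_iff[where f = "\<lambda>b. (-1)^b * tornheim (?a, b)"]) (simp add: tornheim_def)
qed

lemma tornheim_summable: "tornheim summable_on UNIV"
proof -
  have "summable (\<lambda>a. harm a / real a ^ 2 :: real)"
  proof (rule summable_comparison_test')
    show "summable (\<lambda>a. 2 * (real a powr (-3/2)))" by (intro summable_mult) (simp add: summable_real_powr_iff)
    fix a :: nat assume "a \<ge> 0"
    have "harm a / real a ^ 2 \<le> 2 * sqrt (real a) / real a ^ 2"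
      by (intro divide_right_mono harm_le_sqrt) auto
    also have "\<dots> = 2 * (real a powr (-3/2))"
    proof (cases "a = 0")
      case False
      hence "sqrt (real a) / real a ^ 2 = real a powr (1/2) / real a powr 2" by (simp add: powr_half_sqrt)
      also have "\<dots> = real a powr (1/2 - 2)" by (rule powr_diff[symmetric])
      finally show ?thesis by simp
    qed simp
    finally show "norm (harm a / real a ^ 2) \<le> 2 * (real a powr (-3/2))" by (simp add: harm_nonneg)
  qed
  hence "(\<lambda>a. harm a / real a ^ 2 :: real) summable_on UNIV"
    by (rule summable_nonneg_imp_summable_on) (simp add: harm_nonneg)
  with tornheim_row have "tornheim summable_on Sigma UNIV (\<lambda>_. UNIV)"
    by (intro summable_on_SigmaI) (auto simp: tornheim_def)
  thus ?thesis by simp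
qed

lemma weighted_tornheim_summable:
  fixes w :: "nat \<times> nat \<Rightarrow> real"
  assumes "\<And>p. \<bar>w p\<bar> \<le> 1"
  shows "(\<lambda>p. w p * tornheim p) summable_on UNIV"
proof (rule abs_summable_summable, rule summable_on_comparison_test[OF tornheim_summable])
  fix p :: "nat \<times> nat"
  have "tornheim p \<ge> 0" by (simp add: tornheim_def split: prod.splits)
  thus "norm (w p * tornheim p) \<le> tornheim p"
    using mult_right_mono[OF assms[of p], of "tornheim p"] by (simp add: abs_mult)
qed auto

lemma tornheim_antidiagonal:
  "((\<lambda>a. 1 / (real a * real (c - a) * real c)) has_sum 2 * harm (c - 1) / real c ^ 2) {..c}"
proof -
  have inv: "(\<Sum>a=1..<c. 1 / real (c - a)) = (\<Sum>a=1..<c. 1 / real a)"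
    by (rule sum.reindex_bij_witness[of _ "\<lambda>a. c - a" "\<lambda>a. c - a"]) auto
  have "{1..<c} = {1..c - 1}" by auto
  hence h: "(\<Sum>a=1..<c. 1 / real a) = harm (c - 1)" by (simp add: harm_def inverse_eq_divide)
  have "(\<Sum>a\<le>c. 1 / (real a * real (c - a) * real c)) = (\<Sum>a=1..<c. 1 / (real a * real (c - a) * real c))"
  proof (rule sum.mono_neutral_right)
    show "\<forall>a\<in>{..c} - {1..<c}. 1 / (real a * real (c - a) * real c) = 0"
    proof
      fix a assume "a \<in> {..c} - {1..<c}"
      hence "a = 0 \<or> a = c" by auto
      thus "1 / (real a * real (c - a) * real c) = 0" by auto
    qed
  qed auto
  also have "\<dots> = (\<Sum>a=1..<c. (1 / real a + 1 / real (c - a)) / real c ^ 2)"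
  proof (rule sum.cong[OF refl])
    fix a assume a: "a \<in> {1..<c}"
    have pf: "1 / (x * y * (x + y)) = (1 / x + 1 / y) / (x + y) ^ 2" if "x > 0" "y > 0" for x y :: real
    proof -
      have "1 / x + 1 / y = (x + y) / (x * y)" using that by (simp add: field_simps)
      thus ?thesis using that by (simp add: power2_eq_square)
    qed
    have "real a + real (c - a) = real c" using a by simp
    with pf[of "real a" "real (c - a)"] a
    show "1 / (real a * real (c - a) * real c) = (1 / real a + 1 / real (c - a)) / real c ^ 2" by simp
  qed
  also have "\<dots> = 2 * harm (c - 1) / real c ^ 2"
    unfolding sum_divide_distrib[symmetric] sum.distrib inv h by simp
  finally have "(\<Sum>a\<le>c. 1 / (real a * real (c - a) * real c)) = 2 * harm (c - 1) / real c ^ 2" .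
  thus ?thesis using has_sum_finite[OF finite_atMost[of c], of "\<lambda>a. 1 / (real a * real (c - a) * real c)"]
    by (simp only:)
qed

lemma has_sum_diff_real:
  assumes "(f has_sum A) S" "(g has_sum B) S"
  shows "((\<lambda>x. f x - g x :: real) has_sum (A - B)) S"
  using has_sum_add[OF assms(1) has_sum_cmult_right[OF assms(2), of "-1"]] by simp

text \<open>
  Summing along rows gives \<^term>\<open>harm a / real a ^ 2\<close>, summing along antidiagonals gives twice
  \<^term>\<open>harm (c - 1) / real c ^ 2\<close>.  The combination keeps only the last term of the harmonic
  number.  For the constant sign this is Euler's evaluation of \<open>\<Sum> H\<^sub>a / a\<^sup>2\<close>.
\<close>

lemma tornheim_relation:
  fixes s :: "nat \<Rightarrow> real"
  assumes row: "((\<lambda>(a, b). s a * tornheim (a, b)) has_sum A) UNIV"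
    and diag: "((\<lambda>(a, b). s (a + b) * tornheim (a, b)) has_sum B) UNIV"
  shows "((\<lambda>c. s c / real c ^ 3) has_sum (A - B / 2)) UNIV"
proof -
  have "((\<lambda>a. s a * (harm a / real a ^ 2)) has_sum A) UNIV"
  proof (rule has_sum_SigmaD[where B = "\<lambda>_. UNIV"])
    show "((\<lambda>(a, b). s a * tornheim (a, b)) has_sum A) (UNIV \<times> UNIV)" using row by simp
    show "((\<lambda>b. case (a, b) of (a, b) \<Rightarrow> s a * tornheim (a, b)) has_sum s a * (harm a / real a ^ 2)) UNIV" for a
      unfolding prod.case by (intro has_sum_cmult_right tornheim_row)
  qed
  moreover have "((\<lambda>c. s c * (2 * harm (c - 1) / real c ^ 2)) has_sum B) UNIV"
  proof (rule has_sum_SigmaD[where B = "\<lambda>c. {..c}" and f = "\<lambda>(c, a). s c * (1 / (real a * real (c - a) * real c))"])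
    have "((\<lambda>(a, b). s (a + b) * tornheim (a, b)) has_sum B) UNIV \<longleftrightarrow>
      ((\<lambda>(c, a). s c * (1 / (real a * real (c - a) * real c))) has_sum B) (Sigma UNIV (\<lambda>c. {..c}))"
      by (rule has_sum_reindex_bij_witness[where i = "\<lambda>(c, a). (a, c - a)" and j = "\<lambda>(a, b). (a + b, a)"])
        (auto simp: tornheim_def)
    with diag show "((\<lambda>(c, a). s c * (1 / (real a * real (c - a) * real c))) has_sum B) (Sigma UNIV (\<lambda>c. {..c}))" by simp
    fix c
    show "((\<lambda>a. case (c, a) of (c, a) \<Rightarrow> s c * (1 / (real a * real (c - a) * real c))) has_sum s c * (2 * harm (c - 1) / real c ^ 2)) {..c}"
      by (simp only: prod.case) (intro has_sum_cmult_right tornheim_antidiagonal)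
  qed
  ultimately have "((\<lambda>c. s c * (harm c / real c ^ 2) - 1/2 * (s c * (2 * harm (c - 1) / real c ^ 2))) has_sum (A - 1/2 * B)) UNIV"
    by (intro has_sum_diff_real has_sum_cmult_right)
  moreover have "s c * (harm c / real c ^ 2) - 1/2 * (s c * (2 * harm (c - 1) / real c ^ 2)) = s c / real c ^ 3" for c
    by (cases c) (simp_all add: harm_Suc harm_def divide_simps power2_eq_square power3_eq_cube, simp add: algebra_simps)
  ultimately show ?thesis by simp
qed

text \<open>
  An alternating sum is twice the sum over the even arguments minus the full sum.
\<close>

lemma alternating_sum_from_evens:
  assumes "(f has_sum S) (UNIV :: nat set)" "\<And>n. f (2 * n) = c * (f n :: real)"
  shows "((\<lambda>n. (-1)^n * f n) has_sum (2 * c - 1) * S) UNIV"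
proof -
  have "((\<lambda>n. f (2 * n)) has_sum c * S) UNIV" unfolding assms(2) by (intro has_sum_cmult_right assms)
  hence "(f has_sum c * S) (range (\<lambda>n. 2 * n))"
    by (subst has_sum_reindex) (auto simp: inj_on_def o_def)
  also have "?this \<longleftrightarrow> ((\<lambda>n. (1 + (-1)^n) / 2 * f n) has_sum c * S) UNIV"
  proof (rule has_sum_cong_neutral)
    fix n :: nat assume "n \<in> UNIV - range (\<lambda>n. 2 * n)"
    hence "odd n" by (auto elim!: evenE)
    thus "(1 + (-1)^n) / 2 * f n = 0" by simp
  qed auto
  finally have sum: "((\<lambda>n. 2 * ((1 + (-1)^n) / 2 * f n) - f n) has_sum 2 * (c * S) - S) UNIV"
    by (intro has_sum_diff_real has_sum_cmult_right assms)
  have eq: "2 * ((1 + (-1)^n) / 2 * f n) - f n = (-1)^n * f n" for n by (simp add: field_simps)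
  from sum[unfolded eq] show ?thesis by (simp add: algebra_simps)
qed

lemma even_tornheim:
  assumes Z: "(tornheim has_sum Z) UNIV"
  shows "((\<lambda>(a, b). (1 + (-1)^a) * (1 + (-1)^b) / 4 * tornheim (a, b)) has_sum Z / 8) UNIV"
proof -
  let ?d = "\<lambda>(a, b). (2 * a, 2 * b :: nat)"
  have eq: "tornheim (?d p) = 1 / 8 * tornheim p" for p
    by (cases p) (simp add: tornheim_def algebra_simps)
  have "((\<lambda>p. tornheim (?d p)) has_sum (1 / 8 * Z)) UNIV"
    unfolding eq by (intro has_sum_cmult_right Z)
  hence "(tornheim has_sum Z / 8) (range ?d)"
    by (subst has_sum_reindex) (simp_all add: inj_on_def o_def)
  also have "?this \<longleftrightarrow> ((\<lambda>(a, b). (1 + (-1)^a) * (1 + (-1)^b) / 4 * tornheim (a, b)) has_sum Z / 8) UNIV"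
  proof (rule has_sum_cong_neutral)
    fix p :: "nat \<times> nat" assume p: "p \<in> UNIV - range ?d"
    obtain a b where ab: "p = (a, b)" by (cases p)
    have "odd a \<or> odd b"
    proof (rule ccontr)
      assume "\<not> (odd a \<or> odd b)"
      hence "p = ?d (a div 2, b div 2)" by (simp add: ab)
      with p show False by blast
    qed
    thus "(case p of (a, b) \<Rightarrow> (1 + (-1)^a) * (1 + (-1)^b) / 4 * tornheim (a, b)) = 0" by (auto simp: ab)
  qed auto
  finally show ?thesis .
qed

text \<open>
  With \<open>m = 2j+1\<close>, the numerator is \<open>m\<^sup>2\<close> times the sum of \<open>1 + 3(-1)\<^sup>b\<close> against row \<open>m\<close> of the Tornheim series.
  So the claim concerns a combination of the series \<open>Z\<close>, \<open>p\<close>, \<open>q\<close> weighted by \<open>1\<close>, \<open>(-1)\<^sup>a\<close>,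
  \<open>(-1)\<^sup>a\<^sup>+\<^sup>b\<close>.  Comparison of rows and antidiagonals gives \<open>Z / 2 = \<zeta>(3)\<close> and \<open>p - q / 2 = - 3/4 \<zeta>(3)\<close>,
  and homogeneity of the summand gives \<open>2 p + q = - Z / 2\<close>.  Hence \<open>Z\<close>, \<open>p\<close>, \<open>q\<close> are the multiples
  \<open>2\<close>, \<open>- 5/8\<close>, \<open>1/4\<close> of \<open>\<zeta>(3)\<close>, and these cancel in \<open>(Z + 2 p - 3 q) / 2\<close>.
\<close>

lemma odd_harm_euler_sum:
  "(\<lambda>j. (4 * odd_harm (j+1) - harm j - 6 * ln 2) / real (2*j+1) ^ 2) sums 0"
proof -
  \<comment> \<open>The absolutely convergent series weighted by \<open>1\<close>, \<open>(-1)\<^sup>a\<close>, \<open>(-1)\<^sup>a\<^sup>+\<^sup>b\<close>; by symmetry \<open>(-1)\<^sup>b\<close> gives \<open>p\<close> as well.\<close>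
  obtain Z where Z: "(tornheim has_sum Z) UNIV" using tornheim_summable by (auto simp: summable_on_def)
  obtain p where p: "((\<lambda>(a, b). (-1)^a * tornheim (a, b)) has_sum p) UNIV"
    using weighted_tornheim_summable[of "\<lambda>(a, b). (-1)^a"] by (auto simp: summable_on_def case_prod_unfold power_abs)
  obtain q where q: "((\<lambda>(a, b). (-1)^(a + b) * tornheim (a, b)) has_sum q) UNIV"
    using weighted_tornheim_summable[of "\<lambda>(a, b). (-1)^(a + b)"] by (auto simp: summable_on_def case_prod_unfold power_abs)
  have "((\<lambda>(a, b). (-1)^b * tornheim (b, a)) has_sum p) (UNIV \<times> UNIV)"
    using p by (subst has_sum_swap) (simp add: case_prod_unfold)
  hence p': "((\<lambda>(a, b). (-1)^b * tornheim (a, b)) has_sum p) UNIV"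
    by (simp add: tornheim_def mult_ac add_ac)
  have cubes: "((\<lambda>c. 1 / real c ^ 3) has_sum Z / 2) UNIV"
    using tornheim_relation[of "\<lambda>_. 1" Z Z] Z by (simp add: case_prod_unfold)
  have "((\<lambda>c. (-1)^c / real c ^ 3) has_sum (2 * (1/8) - 1) * (Z / 2)) UNIV"
    using alternating_sum_from_evens[OF cubes, of "1/8"] by (simp add: power_mult_distrib)
  moreover have "((\<lambda>c. (-1)^c / real c ^ 3) has_sum p - q / 2) UNIV"
    by (rule tornheim_relation[OF p q])
  ultimately have r1: "p - q / 2 = - (3/8) * Z" using has_sum_unique by fastforce
  have "((\<lambda>x. 1/4 * (tornheim x + (case x of (a, b) \<Rightarrow> (-1)^a * tornheim (a, b)) + (case x of (a, b) \<Rightarrow> (-1)^b * tornheim (a, b))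
     + (case x of (a, b) \<Rightarrow> (-1)^(a + b) * tornheim (a, b)))) has_sum 1/4 * (Z + p + p + q)) UNIV"
    by (intro has_sum_cmult_right has_sum_add Z p p' q)
  also have "(\<lambda>x. 1/4 * (tornheim x + (case x of (a, b) \<Rightarrow> (-1)^a * tornheim (a, b)) + (case x of (a, b) \<Rightarrow> (-1)^b * tornheim (a, b))
     + (case x of (a, b) \<Rightarrow> (-1)^(a + b) * tornheim (a, b)))) = (\<lambda>(a, b). (1 + (-1)^a) * (1 + (-1)^b) / 4 * tornheim (a, b))"
    by (auto simp: fun_eq_iff power_add algebra_simps)
  \<comment> \<open>Averaging over signs selects the even pairs, whose sum is \<open>Z / 8\<close> by homogeneity.\<close>
  finally have r2: "1/4 * (Z + p + p + q) = Z / 8" using even_tornheim[OF Z] has_sum_unique by blast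
  have "((\<lambda>x. 1/2 * (tornheim x - (case x of (a, b) \<Rightarrow> (-1)^a * tornheim (a, b)) + 3 * (case x of (a, b) \<Rightarrow> (-1)^b * tornheim (a, b))
     - 3 * (case x of (a, b) \<Rightarrow> (-1)^(a + b) * tornheim (a, b)))) has_sum 1/2 * (Z - p + 3 * p - 3 * q)) UNIV"
    by (intro has_sum_cmult_right has_sum_add has_sum_diff_real Z p p' q)
  also have "(\<lambda>x. 1/2 * (tornheim x - (case x of (a, b) \<Rightarrow> (-1)^a * tornheim (a, b)) + 3 * (case x of (a, b) \<Rightarrow> (-1)^b * tornheim (a, b))
     - 3 * (case x of (a, b) \<Rightarrow> (-1)^(a + b) * tornheim (a, b)))) =
     (\<lambda>(a, b). (1 - (-1)^a) / 2 * (tornheim (a, b) + 3 * ((-1)^b * tornheim (a, b))))"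
    by (auto simp: fun_eq_iff power_add field_simps)
  also have "1/2 * (Z - p + 3 * p - 3 * q) = 0" using r1 r2 by simp
  finally have "((\<lambda>(a, b). (1 - (-1)^a) / 2 * (tornheim (a, b) + 3 * ((-1)^b * tornheim (a, b)))) has_sum 0) (UNIV \<times> UNIV)"
    by simp
  \<comment> \<open>The weight \<open>(1 - (-1)\<^sup>a) / 2\<close> selects the odd rows.\<close>
  moreover define h where "h = (\<lambda>a. if even a then 0 else
     (4 * odd_harm (a div 2 + 1) - harm (a div 2) - 6 * ln 2) / real a ^ 2)"
  have "((\<lambda>b. case (a, b) of (a, b) \<Rightarrow> (1 - (-1)^a) / 2 * (tornheim (a, b) + 3 * ((-1)^b * tornheim (a, b)))) has_sum h a) UNIV" for a
  proof (cases "even a")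
    case False
    then obtain j where j: "a = 2 * j + 1" by (auto elim: oddE)
    have "harm a = odd_harm (j + 1) + harm j / (2::real)"
      using harm_double[of j] by (simp add: j harm_Suc odd_harm_def inverse_eq_divide)
    hence "harm a / real a ^ 2 + 3 * ((odd_harm (j + 1) - harm j / 2 - 2 * ln 2) / real a ^ 2) = h a"
      by (simp add: h_def j add_divide_distrib diff_divide_distrib)
    moreover have "((\<lambda>b. tornheim (a, b) + 3 * ((-1)^b * tornheim (a, b))) has_sum
        harm a / real a ^ 2 + 3 * ((odd_harm (j + 1) - harm j / 2 - 2 * ln 2) / real a ^ 2)) UNIV"
      using tornheim_row_alternating[of j] unfolding j[symmetric]
      by (intro has_sum_add has_sum_cmult_right tornheim_row)
    moreover have "(1 - (-1)^a) / 2 = (1::real)" using False by simp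
    ultimately show ?thesis by (simp only: prod.case mult_1_left)
  qed (simp add: h_def)
  ultimately have "(h has_sum 0) UNIV" by (rule has_sum_SigmaD)
  also have "?this \<longleftrightarrow> (h has_sum 0) (range (\<lambda>j. 2 * j + 1))"
  proof (rule has_sum_cong_neutral)
    fix a assume "a \<in> UNIV - range (\<lambda>j. 2 * j + 1 :: nat)"
    hence "even a" by (metis DiffD2 oddE rangeI)
    thus "h a = 0" by (simp add: h_def)
  qed auto
  also have "\<dots> \<longleftrightarrow> ((\<lambda>j. h (2 * j + 1)) has_sum 0) UNIV"
    by (subst has_sum_reindex) (auto simp: inj_on_def o_def)
  finally have "(\<lambda>j. h (2 * j + 1)) sums 0" by (rule has_sum_imp_sums)
  thus ?thesis by (simp add: h_def)
qed

section \<open>The initial row\<close>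

lemma sums_odd_powers:
  assumes "(\<lambda>n. 1 / (real n + 1) ^ p) sums S"
  shows "(\<lambda>n. 1 / (2 * real n + 1) ^ p) sums (S - S / 2 ^ p)"
proof -
  have "(\<lambda>n. \<Sum>i = n * 2..<n * 2 + 2. 1 / (real i + 1) ^ p) sums S"
    using assms by (rule sums_group) simp
  from sums_diff[OF this sums_divide[OF assms, of "2 ^ p"]]
  have "(\<lambda>n. (\<Sum>i = n * 2..<n * 2 + 2. 1 / (real i + 1) ^ p) - 1 / (real n + 1) ^ p / 2 ^ p) sums (S - S / 2 ^ p)" .
  moreover have "(\<Sum>i = n * 2..<n * 2 + 2. 1 / (real i + 1) ^ p) - 1 / (real n + 1) ^ p / 2 ^ p
      = 1 / (2 * real n + 1) ^ p" for n
  proof -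
    have "{n * 2..<n * 2 + 2} = {2 * n, 2 * n + 1}" by auto
    moreover have "(2 * real n + 2) ^ p = (real n + 1) ^ p * 2 ^ p"
      by (simp flip: power_mult_distrib add: algebra_simps)
    ultimately show ?thesis by (simp add: add_ac)
  qed
  ultimately show ?thesis by simp
qed

lemma zeta_3_sums: "(\<lambda>n. 1 / (real n + 1) ^ 3) sums zeta 3"
proof -
  have eq: "1 / real (Suc n) powr 3 = 1 / (real n + 1) ^ 3" for n
    by (simp add: powr_numeral add_ac)
  have "summable (\<lambda>n. 1 / (real n + 1) ^ 3)"
    using inverse_power_summable[of 3, where 'a = real] summable_Suc_iff[of "\<lambda>n. inverse (real n ^ 3)"]
    by (simp add: inverse_eq_divide add_ac)
  thus ?thesis unfolding zeta_def eq by (rule summable_sums)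
qed

lemma Digamma_half_odd_harm: "Digamma (real n + 1/2) = 2 * odd_harm n - euler_mascheroni - 2 * ln 2"
  using Digamma_half_integer[of n, where 'a = real]
  by (simp add: odd_harm_def sum_distrib_left add_ac)

lemma Digamma_harm: "Digamma (real n + 1) = harm n - euler_mascheroni"
  using Digamma_of_nat[of n, where 'a = real] by (simp add: add_ac)

lemma ln_16: "ln 16 = 4 * ln (2::real)"
  using ln_realpow[of 2 4] by simp

text \<open>
  In row 0 the Gamma factors collapse to \<open>4 / (2k+1)\<^sup>2\<close>.  The logarithmic derivative consists of
  a harmonic part, which is the vanishing Euler sum, and a rational part, which yields
  \<open>\<Sum> 1 / (2k+1)\<^sup>3 = 7/8 \<zeta>(3)\<close>.
\<close>

lemma wz_term_deriv_0_sums: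
  "(\<lambda>k. wz_term_deriv g a b 0 (real k + 1)) sums (g * pi^2 / 2 - 14 * (a + b) * zeta 3)"
proof -
  have two: "(\<lambda>k. 1 / (2 * real k + 1) ^ 2) sums (pi^2 / 8)"
  proof -
    have "(\<lambda>n. 1 / (real n + 1) ^ 2) sums (pi^2 / 6)" using inverse_squares_sums by (simp add: add_ac)
    from sums_odd_powers[OF this] show ?thesis by simp
  qed
  have three: "(\<lambda>k. 1 / (2 * real k + 1) ^ 3) sums (7/8 * zeta 3)"
    using sums_odd_powers[OF zeta_3_sums] by simp
  have euler: "(\<lambda>k. (4 * odd_harm (k+1) - harm k - 6 * ln 2) / (2 * real k + 1) ^ 2) sums 0"
    using odd_harm_euler_sum by (simp add: add_ac)
  have eq: "wz_term_deriv g a b 0 (real k + 1) = 4 * g * (1 / (2 * real k + 1) ^ 2)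
      - 8 * a * ((4 * odd_harm (k+1) - harm k - 6 * ln 2) / (2 * real k + 1) ^ 2)
      - 16 * (a + b) * (1 / (2 * real k + 1) ^ 3)" for k
  proof -
    define w where "w = 2 * real k + 1"
    have w: "w > 0" by (simp add: w_def)
    have t: "wz_term 0 (real k + 1) = 4 / w ^ 2"
      using wz_term_0[of "real k + 1"] by (simp add: w_def power2_eq_square field_simps)
    have "odd_harm (k + 1) = odd_harm k + 1 / w" by (simp add: odd_harm_def w_def)
    hence psi: "Digamma (real k + 1/2) = 2 * (odd_harm (k+1) - 1 / w) - euler_mascheroni - 2 * ln 2"
       "Digamma (real k + 3/2) = 2 * odd_harm (k+1) - euler_mascheroni - 2 * ln 2"
       "Digamma (real k + 1) = harm k - euler_mascheroni"
      using Digamma_half_odd_harm[of k] Digamma_half_odd_harm[of "k+1"] Digamma_harm[of k] by (simp_all add: add_ac)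
    have l: "wz_logderiv a b 0 (real k + 1) = a * (12 * ln 2 + 2 * harm k - 8 * odd_harm (k+1) - 4 / w) - 4 * b / w"
    proof -
      have e: "real k + 1 - 1/2 = real k + 1/2" "real k + 1 + 1/2 = real k + 3/2" by simp_all
      show ?thesis unfolding wz_logderiv_def mult_zero_right add_0_left e psi ln_16 Digamma_1 by (simp add: algebra_simps)
    qed
    show ?thesis unfolding wz_term_deriv_def t l w_def[symmetric] using w
      by (simp add: field_simps power2_eq_square power3_eq_cube)
  qed
  have "(\<lambda>k. 4 * g * (1 / (2 * real k + 1) ^ 2)
      - 8 * a * ((4 * odd_harm (k+1) - harm k - 6 * ln 2) / (2 * real k + 1) ^ 2)
      - 16 * (a + b) * (1 / (2 * real k + 1) ^ 3)) sums (4 * g * (pi^2 / 8) - 8 * a * 0 - 16 * (a + b) * (7/8 * zeta 3))"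
    by (intro sums_diff sums_mult two three euler)
  also have "4 * g * (pi^2 / 8) - 8 * a * 0 - 16 * (a + b) * (7/8 * zeta 3) = g * pi^2 / 2 - 14 * (a + b) * zeta 3"
    by (simp add: algebra_simps)
  finally show ?thesis unfolding eq .
qed

section \<open>The boundary values\<close>

lemma wz_logderiv_1:
  "wz_logderiv a b (real n) 1 =
     a * (12 * ln 2 + 2 * harm (2*n) + harm n + 9 * harm (3*n) - 12 * harm (6*n) - 12 / (6 * real n + 1))
   + b * (4 * harm (2*n) - 3 * harm n + 3 * harm (3*n) - 4 * harm (6*n) - 4 / (6 * real n + 1))"
proof -
  have o1: "odd_harm n = harm (2*n) - harm n / 2" using harm_double[of n] by simp
  have o3: "odd_harm (3*n+1) = harm (6*n) - harm (3*n) / 2 + 1 / (6 * real n + 1)"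
    using harm_double[of "3*n"] by (simp add: odd_harm_def)
  have psi: "Digamma (real n + 1 - 1/2) = 2 * odd_harm n - euler_mascheroni - 2 * ln 2"
     "Digamma (3 * real n + 1 + 1/2) = 2 * odd_harm (3*n+1) - euler_mascheroni - 2 * ln 2"
     "Digamma (3 * real n + 1) = harm (3*n) - euler_mascheroni"
     "Digamma (2 * real n + 1) = harm (2*n) - euler_mascheroni"
     "Digamma (real n + 1) = harm n - euler_mascheroni"
    using Digamma_half_odd_harm[of n] Digamma_half_odd_harm[of "3*n+1"] Digamma_harm[of "3*n"]
      Digamma_harm[of "2*n"] Digamma_harm[of n] by (simp_all add: add_ac)
  show ?thesis unfolding wz_logderiv_def psi ln_16 o1 o3 by (simp add: algebra_simps)
qed

lemma wz_cert_1:
  assumes "x \<ge> 0"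
  shows "wz_cert x 1 = P (x + 1) / (9 * (2*x + 1) * (6*x + 5)^2)"
proof -
  have num: "wz_num x 1 = P (x + 1) * (2*x + 1)^2" unfolding wz_num_def P_def power_one mult_1_right by algebra
  have den: "wz_den x 1 = 9 * (2*x + 1) * (6*x + 5)^2 * (2*x + 1)^2" unfolding wz_den_def mult_1_right by algebra
  show ?thesis unfolding wz_cert_def num den using assms by simp
qed

text \<open>
  The two directions are those in which the logarithmic derivative reduces to the harmonic numbers
  of the two summands; the digamma function at \<open>3x+3/2\<close> leaves the extra term \<open>20 / (6x+1)\<close>
  in the second case only.
\<close>

lemma wz_cert_deriv_1:
  assumes "x \<ge> 0"
  shows "wz_cert_deriv (-1/2) (3/2) x 1 =
      (5 * P (x + 1) / (2*x + 1) - 1656 * (x + 1)^2 + 576 * (x + 1) - 53) / (9 * (2*x + 1) * (6*x + 5)^2)" (is ?th1)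
    "20 / (6*x + 1) * wz_cert x 1 + wz_cert_deriv (-2) 1 x 1 =
      (5 * P (x + 1) * (4 * (1 / (6*x+1) + 1 / (6*x+2) + 1 / (6*x+3) + 1 / (6*x+4) + 1 / (6*x+5)) - 3 * (1 / (3*x+1) + 1 / (3*x+2)))
       - Q (x + 1) / ((3*x + 2) * (3*x + 1))) / (9 * (2*x + 1) * (6*x + 5)^2)" (is ?th2)
proof -
  define w v where "w = 2*x + 1" and "v = 6*x + 5"
  have pos: "w > 0" "v > 0" "3*x+1 > 0" "3*x+2 > 0" "6*x+1 > 0" using assms by (auto simp: w_def v_def)
  have d: "6*x + 2*1 + 1 = 3 * w" "6*x + 2*1 + 3 = v" by (auto simp: w_def v_def)
  have den: "wz_den x 1 = 9 * w * v^2 * w^2" unfolding wz_den_def w_def v_def mult_1_right by algebra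
  have cert: "wz_cert x 1 = P (x + 1) / (9 * w * v^2)" unfolding w_def v_def by (rule wz_cert_1[OF assms])
  define D where "D = 9 * w * v^2"
  have D: "D > 0" using pos by (simp add: D_def)
  have gen: "wz_cert_deriv a b x 1 = ((a * wz_num_deriv_left x 1 + b * wz_num_deriv_right x 1) / w^2
      - P (x + 1) * (2 * a / w + 4 * (3*a+b) / (3 * w) + 4 * (3*a+b) / v)) / D" for a b
    unfolding wz_cert_deriv_def den cert d w_def[symmetric] D_def[symmetric] using D
    by (simp add: diff_divide_distrib)
  have n1: "(-1/2) * wz_num_deriv_left x 1 + 3/2 * wz_num_deriv_right x 1
     = (4 * P (x + 1) + w * (- 1656 * (x + 1)^2 + 576 * (x + 1) - 53)) * w"
    unfolding wz_num_deriv_left_def wz_num_deriv_right_def P_def w_def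
    by (simp add: field_simps power2_eq_square power3_eq_cube power4_eq_xxxx)
  show ?th1 unfolding gen n1 w_def[symmetric] v_def[symmetric] D_def[symmetric] using pos D
    by (simp add: field_simps power2_eq_square)
  have n2: "((-2) * wz_num_deriv_left x 1 + 1 * wz_num_deriv_right x 1 + 4 * P (x + 1) * w) * ((3*x+1) * (3*x+2))
     = w^2 * (- 15 * P (x + 1) * w - Q (x + 1))"
    unfolding wz_num_deriv_left_def wz_num_deriv_right_def P_def Q_def w_def power_one mult_1_right by algebra
  have clear: "N / w^2 + 4 * p / w = ((N + 4 * p * w) * r) / (w^2 * r)" if "r > 0" for N p r
    using pos that by (simp add: field_simps power2_eq_square)
  have "((-2) * wz_num_deriv_left x 1 + 1 * wz_num_deriv_right x 1) / w^2 + 4 * P (x + 1) / w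
     = (((-2) * wz_num_deriv_left x 1 + 1 * wz_num_deriv_right x 1 + 4 * P (x + 1) * w) * ((3*x+1) * (3*x+2)))
       / (w^2 * ((3*x+1) * (3*x+2)))"
    by (rule clear) (use pos in simp)
  also have "\<dots> = (- 15 * P (x + 1) * w - Q (x + 1)) / ((3*x+1) * (3*x+2))"
    unfolding n2 using pos by simp
  finally have n3: "((-2) * wz_num_deriv_left x 1 + 1 * wz_num_deriv_right x 1) / w^2
     = (- 15 * P (x + 1) * w - Q (x + 1)) / ((3*x+1) * (3*x+2)) - 4 * P (x + 1) / w" by simp
  have pf: "1 / (3*x+1) + 1 / (3*x+2) = 3 * w / ((3*x+1) * (3*x+2))"
    using pos by (simp add: w_def field_simps)
  have h: "1 / (6*x+2) = 1/2 * (1 / (3*x+1))" "1 / (6*x+4) = 1/2 * (1 / (3*x+2))" "1 / (6*x+3) = 1 / (3 * w)"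
    using pos by (simp_all add: w_def field_simps)
  define r where "r = (3*x+1) * (3*x+2)"
  define s1 s2 where "s1 = 1 / (3*x+1)" and "s2 = 1 / (3*x+2)"
  have pf': "s1 + s2 = 3 * w / r" unfolding s1_def s2_def r_def by (rule pf)
  have "20 / (6*x + 1) * wz_cert x 1 + wz_cert_deriv (-2) 1 x 1
     = (20 / (6*x + 1) * P (x + 1) + ((- 15 * P (x + 1) * w - Q (x + 1)) / r - 4 * P (x + 1) / w
      - P (x + 1) * (2 * (-2) / w + 4 * (3*(-2)+1) / (3 * w) + 4 * (3*(-2)+1) / v))) / D"
    unfolding gen cert n3 r_def[symmetric] D_def[symmetric] by (simp add: add_divide_distrib)
  also have "20 / (6*x + 1) * P (x + 1) + ((- 15 * P (x + 1) * w - Q (x + 1)) / r - 4 * P (x + 1) / w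
      - P (x + 1) * (2 * (-2) / w + 4 * (3*(-2)+1) / (3 * w) + 4 * (3*(-2)+1) / v))
    = 5 * P (x + 1) * (4 * (1 / (6*x+1) + 1 / (3 * w) + 1 / v) - 3 * w / r) - Q (x + 1) / r"
    unfolding divide_inverse inverse_mult_distrib by (simp add: algebra_simps)
  also have "4 * (1 / (6*x+1) + 1 / (3 * w) + 1 / v) - 3 * w / r
     = 4 * (1 / (6*x+1) + 1/2 * s1 + 1 / (3 * w) + 1/2 * s2 + 1 / v) - 3 * (s1 + s2)"
    unfolding pf'[symmetric] by (simp add: algebra_simps)
  finally show ?th2 unfolding h v_def[symmetric] s1_def[symmetric] s2_def[symmetric] D_def r_def w_def[symmetric]
    by (simp only: mult.commute[of "3*x+1"])
qed

definition summand_weight :: "nat \<Rightarrow> real" where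
  "summand_weight k = 4096 ^ k / denom k"

lemma summand_weight_fact:
  "summand_weight (Suc n) = 4096 ^ Suc n * fact (Suc n) * fact (2 * Suc n) * fact (3 * Suc n) ^ 3
     / ((real n + 1)^3 * (3 * real n + 2) * (3 * real n + 1) * fact (6 * Suc n) ^ 2)"
proof -
  have le: "Suc n \<le> 3 * Suc n" "3 * Suc n \<le> 6 * Suc n" by simp_all
  have m: "3 * Suc n - Suc n = 2 * Suc n" "6 * Suc n - 3 * Suc n = 3 * Suc n" by simp_all
  have c1: "real ((3 * Suc n) choose Suc n) = fact (3 * Suc n) / (fact (Suc n) * fact (2 * Suc n))"
    using binomial_fact[OF le(1), where 'a = real] unfolding m .
  have c2: "real ((6 * Suc n) choose (3 * Suc n)) = fact (6 * Suc n) / (fact (3 * Suc n) * fact (3 * Suc n))"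
    using binomial_fact[OF le(2), where 'a = real] unfolding m .
  have l: "real (Suc n) = real n + 1" "3 * (real n + 1) - 1 = 3 * real n + 2" "3 * (real n + 1) - 2 = 3 * real n + 1" by simp_all
  have gen: "K / (A * B * C * (f3 / (f1 * f2)) * (f6 / (f3 * f3))^2) = K * f1 * f2 * f3^3 / (A * B * C * f6^2)"
    if "f1 > 0" "f2 > 0" "f3 > 0" "f6 > 0" "A > 0" "B > 0" "C > 0" for K A B C f1 f2 f3 f6 :: real
    using that by (simp add: field_simps power2_eq_square power3_eq_cube)
  show ?thesis unfolding summand_weight_def denom_def c1 c2 l by (rule gen) (simp_all del: fact_Suc)
qed

text \<open>
  At \<open>y = 1\<close> the Gamma factors are, up to a rational function, the powers of 4096 and the reciprocal binomial
  coefficients of the series.  Comparing quotients of consecutive terms avoids the duplication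
  formulas.
\<close>

lemma wz_term_1: "wz_term (real n) 1 = summand_weight (Suc n) * (9 * (2 * real n + 1) * (6 * real n + 5)^2) / 96"
proof (induction n)
  case 0
  show ?case using wz_term_0[of 1] by (simp add: summand_weight_def denom_def power2_eq_square binomial_fact fact_numeral)
next
  case (Suc n)
  define x where "x = real n"
  have x: "x \<ge> 0" by (simp add: x_def)
  have rec: "summand_weight (Suc (Suc n)) = summand_weight (Suc n) *
     (4096 * (x+2) * (2*x+3) * (2*x+4) * ((3*x+4)*(3*x+5)*(3*x+6))^3 * ((x+1)^3 * (3*x+2) * (3*x+1))
      / (((6*x+7)*(6*x+8)*(6*x+9)*(6*x+10)*(6*x+11)*(6*x+12))^2 * ((x+2)^3 * (3*x+5) * (3*x+4))))"
  proof -
    have f: "fact (Suc (Suc n)) = (x+2) * fact (Suc n)"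
      "fact (2 * Suc (Suc n)) = (2*x+3) * (2*x+4) * fact (2 * Suc n)"
      "fact (3 * Suc (Suc n)) = (3*x+4)*(3*x+5)*(3*x+6) * fact (3 * Suc n)"
      "fact (6 * Suc (Suc n)) = (6*x+7)*(6*x+8)*(6*x+9)*(6*x+10)*(6*x+11)*(6*x+12) * fact (6 * Suc n)"
    proof -
      have s: "2 * Suc (Suc n) = Suc (Suc (2 * Suc n))" "3 * Suc (Suc n) = Suc (Suc (Suc (3 * Suc n)))"
        "6 * Suc (Suc n) = Suc (Suc (Suc (Suc (Suc (Suc (6 * Suc n))))))" by simp_all
      have r: "real (Suc (Suc n)) = x + 2" "real (Suc (2 * Suc n)) = 2*x+3" "real (Suc (Suc (2 * Suc n))) = 2*x+4"
        "real (Suc (3 * Suc n)) = 3*x+4" "real (Suc (Suc (3 * Suc n))) = 3*x+5" "real (Suc (Suc (Suc (3 * Suc n)))) = 3*x+6"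
        "real (Suc (6 * Suc n)) = 6*x+7" "real (Suc (Suc (6 * Suc n))) = 6*x+8"
        "real (Suc (Suc (Suc (6 * Suc n)))) = 6*x+9" "real (Suc (Suc (Suc (Suc (6 * Suc n))))) = 6*x+10"
        "real (Suc (Suc (Suc (Suc (Suc (6 * Suc n)))))) = 6*x+11" "real (Suc (Suc (Suc (Suc (Suc (Suc (6 * Suc n))))))) = 6*x+12"
        by (simp_all add: x_def)
      show "fact (Suc (Suc n)) = (x+2) * fact (Suc n)" unfolding fact_Suc[of "Suc n"] r ..
      show "fact (2 * Suc (Suc n)) = (2*x+3) * (2*x+4) * fact (2 * Suc n)"
        unfolding s fact_Suc[of "Suc (2 * Suc n)"] fact_Suc[of "2 * Suc n"] r by (simp only: mult_ac)
      show "fact (3 * Suc (Suc n)) = (3*x+4)*(3*x+5)*(3*x+6) * fact (3 * Suc n)"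
        unfolding s fact_Suc[of "Suc (Suc (3 * Suc n))"] fact_Suc[of "Suc (3 * Suc n)"] fact_Suc[of "3 * Suc n"] r by (simp only: mult_ac)
      show "fact (6 * Suc (Suc n)) = (6*x+7)*(6*x+8)*(6*x+9)*(6*x+10)*(6*x+11)*(6*x+12) * fact (6 * Suc n)"
        unfolding s fact_Suc[of "Suc (Suc (Suc (Suc (Suc (6 * Suc n)))))"] fact_Suc[of "Suc (Suc (Suc (Suc (6 * Suc n))))"]
          fact_Suc[of "Suc (Suc (Suc (6 * Suc n)))"] fact_Suc[of "Suc (Suc (6 * Suc n))"]
          fact_Suc[of "Suc (6 * Suc n)"] fact_Suc[of "6 * Suc n"] r by (simp only: mult_ac)
    qed
    have n1: "real (Suc n) = x + 1" by (simp add: x_def)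
    have e: "3 * (x+1) + 2 = 3*x+5" "3 * (x+1) + 1 = 3*x+4" "x + 1 + 1 = x + 2" by simp_all
    have "(4096 * K) * (p1 * f1) * (p2 * f2) * (p3 * f3)^3 / (A' * (p6 * f6)^2)
       = K * f1 * f2 * f3^3 / (A * f6^2) * (4096 * p1 * p2 * p3^3 * A / (p6^2 * A'))"
      if "A > 0" "A' > 0" "p6 > 0" "f6 > 0" for K p1 p2 p3 p6 f1 f2 f3 f6 A A' :: real
      using that by (simp add: field_simps)
    from this[of "(x+1)^3 * (3*x+2) * (3*x+1)" "(x+2)^3 * (3*x+5) * (3*x+4)"
       "(6*x+7)*(6*x+8)*(6*x+9)*(6*x+10)*(6*x+11)*(6*x+12)" "fact (6 * Suc n)" "4096 ^ Suc n"
       "x+2" "fact (Suc n)" "(2*x+3)*(2*x+4)" "fact (2 * Suc n)" "(3*x+4)*(3*x+5)*(3*x+6)" "fact (3 * Suc n)"]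
    show ?thesis using x unfolding summand_weight_fact f n1 x_def[symmetric] e power_Suc[of _ "Suc n"]
      by (simp only: mult_ac) simp
  qed
  have "wz_dom x 1" using x by (simp add: wz_dom_def)
  from wz_term_Suc_left[OF this]
  have "wz_term (real (Suc n)) 1 = wz_term x 1 * (16 * (x+1-1/2)^2 * (3*x+1) * (3*x+1+1) * (3*x+1+2) * (x+1)^4
     / ((3*x+1+1/2)^2 * (3*x+1+3/2)^2 * (3*x+1+5/2)^2 * (x+1) * (2*x+1) * (2*x+2)))" by (simp add: x_def add_ac)
  also have "wz_term x 1 = summand_weight (Suc n) * (9 * (2*x+1) * (6*x+5)^2) / 96" using Suc.IH by (simp add: x_def)
  also have "summand_weight (Suc n) * (9 * (2*x+1) * (6*x+5)^2) / 96 * (16 * (x+1-1/2)^2 * (3*x+1) * (3*x+1+1) * (3*x+1+2) * (x+1)^4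
     / ((3*x+1+1/2)^2 * (3*x+1+3/2)^2 * (3*x+1+5/2)^2 * (x+1) * (2*x+1) * (2*x+2)))
    = summand_weight (Suc (Suc n)) * (9 * (2*x+3) * (6*x+11)^2) / 96"
  proof -
    have e: "x+1-1/2 = (2*x+1)/2" "3*x+1+1/2 = 3*(2*x+1)/2" "3*x+1+3/2 = (6*x+5)/2" "3*x+1+5/2 = (6*x+7)/2"
      "3*x+1+1 = 3*x+2" "3*x+1+2 = 3*(x+1)" "2*x+2 = 2*(x+1)" "2*x+4 = 2*(x+2)" "3*x+6 = 3*(x+2)"
      "6*x+8 = 2*(3*x+4)" "6*x+9 = 3*(2*x+3)" "6*x+10 = 2*(3*x+5)" "6*x+12 = 6*(x+2)" by simp_all
    have pos: "2*x+1 > 0" "6*x+5 > 0" "6*x+7 > 0" "x+1 > 0" "x+2 > 0" "3*x+4 > 0" "2*x+3 > 0" "3*x+5 > 0"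
      "6*x+11 > 0" "3*x+1 > 0" "3*x+2 > 0" using x by simp_all
    \<comment> \<open>Each variable stands for one linear factor, so that both quotients cancel without expansion.\<close>
    have "W * (9 * p1 * p2^2) / 96 * (16 * (p1/2)^2 * q1 * q2 * (3*p4) * p4^4 / ((3*p1/2)^2 * (p2/2)^2 * (p3/2)^2 * p4 * p1 * (2*p4)))
       = W * (4096 * p5 * p7 * (2*p5) * (p6*p8*(3*p5))^3 * (p4^3 * q2 * q1)
      / ((p3*(2*p6)*(3*p7)*(2*p8)*p9*(6*p5))^2 * (p5^3 * p8 * p6))) * (9 * p7 * p9^2) / 96"
      if "p1 > 0" "p2 > 0" "p3 > 0" "p4 > 0" "p5 > 0" "p6 > 0" "p7 > 0" "p8 > 0" "p9 > 0" "q1 > 0" "q2 > 0"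
      for W p1 p2 p3 p4 p5 p6 p7 p8 p9 q1 q2 :: real
      using that by (simp add: field_simps eval_nat_numeral)
    from this[OF pos] show ?thesis unfolding rec unfolding e .
  qed
  finally show ?case by (simp add: x_def algebra_simps)
qed

lemma summand1_eq: "summand1 (Suc n) = 96 * wz_mate_deriv (6 * ln 2) (-1/2) (3/2) (real n) 1"
proof -
  define D where "D = 9 * (2 * real n + 1) * (6 * real n + 5)^2"
  have D: "D > 0" by (simp add: D_def)
  have h: "harm (2 * Suc n - 1) = harm (2*n) + 1 / (2 * real n + 1)" "harm (Suc n - 1) = harm n"
    by (simp_all add: harm_Suc inverse_eq_divide add_ac)
  have L: "6 * ln 2 + wz_logderiv (-1/2) (3/2) (real n) 1 = 5 * (harm (2*n) - harm n)"
  proof -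
    define r where "r = 1 / (6 * real n + 1)"
    have r: "12 / (6 * real n + 1) = 12 * r" "4 / (6 * real n + 1) = 4 * r" by (simp_all add: r_def)
    show ?thesis unfolding wz_logderiv_1 r by (simp add: algebra_simps)
  qed
  have "96 * wz_mate_deriv (6 * ln 2) (-1/2) (3/2) (real n) 1 = summand_weight (Suc n) *
     (5 * P (real n + 1) * (harm (2*n) - harm n) + (5 * P (real n + 1) / (2 * real n + 1) - 1656 * (real n + 1)^2 + 576 * (real n + 1) - 53))"
    unfolding wz_mate_deriv_def L wz_term_1 wz_cert_1[OF of_nat_0_le_iff] wz_cert_deriv_1(1)[OF of_nat_0_le_iff] D_def[symmetric]
  proof -
    have "96 * (W * D / 96 * (5 * h * (p / D) + t / D)) = W * (5 * p * h + t)" for W h p t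
      using D by (simp add: field_simps)
    thus "96 * (summand_weight (Suc n) * D / 96 * (5 * (harm (2 * n) - harm n) * (P (real n + 1) / D)
        + (5 * P (real n + 1) / (2 * real n + 1) - 1656 * (real n + 1)\<^sup>2 + 576 * (real n + 1) - 53) / D)) =
      summand_weight (Suc n) * (5 * P (real n + 1) * (harm (2 * n) - harm n)
        + (5 * P (real n + 1) / (2 * real n + 1) - 1656 * (real n + 1)\<^sup>2 + 576 * (real n + 1) - 53))" .
  qed
  also have "5 * P (real n + 1) * (harm (2*n) - harm n) + (5 * P (real n + 1) / (2 * real n + 1) - 1656 * (real n + 1)^2 + 576 * (real n + 1) - 53)
      = 5 * P (real n + 1) * (harm (2*n) + 1 / (2 * real n + 1) - harm n) - 1656 * (real n + 1)^2 + 576 * (real n + 1) - 53"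
    by (simp add: algebra_simps)
  also have "summand_weight (Suc n) * \<dots> = summand1 (Suc n)"
  proof -
    have r: "real (Suc n) = real n + 1" by simp
    show ?thesis unfolding summand1_def summand_weight_def h r by simp
  qed
  finally show ?thesis ..
qed

lemma summand2_eq: "summand2 (Suc n) = 96 * wz_mate_deriv (24 * ln 2) (-2) 1 (real n) 1"
proof -
  define x where "x = real n"
  define D where "D = 9 * (2 * x + 1) * (6 * x + 5)^2"
  have D: "D > 0" by (simp add: D_def x_def)
  define d where "d = 4 * (1 / (6*x+1) + 1 / (6*x+2) + 1 / (6*x+3) + 1 / (6*x+4) + 1 / (6*x+5)) - 3 * (1 / (3*x+1) + 1 / (3*x+2))"
  define B where "B = 4 * harm (6*n) - 3 * harm (3*n) - (harm n :: real)"
  have n6: "6 * Suc n - 1 = Suc (Suc (Suc (Suc (Suc (6*n)))))" and n3: "3 * Suc n - 1 = Suc (Suc (3*n))" by simp_all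
  have h: "4 * harm (6 * Suc n - 1) - 3 * harm (3 * Suc n - 1) - harm (Suc n - 1) = B + d"
    unfolding n6 n3 by (simp add: harm_Suc inverse_eq_divide add_ac B_def d_def x_def)
  have L: "24 * ln 2 + wz_logderiv (-2) 1 x 1 = 5 * B + 20 / (6*x+1)"
  proof -
    define r where "r = 1 / (6 * real n + 1)"
    have r: "12 / (6 * real n + 1) = 12 * r" "4 / (6 * real n + 1) = 4 * r" "20 / (6 * real n + 1) = 20 * r"
      by (simp_all add: r_def)
    show ?thesis unfolding x_def wz_logderiv_1 r B_def by (simp add: algebra_simps)
  qed
  have "96 * wz_mate_deriv (24 * ln 2) (-2) 1 (real n) 1
      = 96 * wz_term x 1 * (5 * B * wz_cert x 1 + (20 / (6*x+1) * wz_cert x 1 + wz_cert_deriv (-2) 1 x 1))"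
    unfolding wz_mate_deriv_def x_def[symmetric] L by (simp add: algebra_simps)
  also have "20 / (6*x+1) * wz_cert x 1 + wz_cert_deriv (-2) 1 x 1
      = (5 * P (x + 1) * d - Q (x + 1) / ((3*x + 2) * (3*x + 1))) / D"
    unfolding d_def D_def by (rule wz_cert_deriv_1(2)) (simp add: x_def)
  also have "wz_cert x 1 = P (x + 1) / D" unfolding D_def by (rule wz_cert_1) (simp add: x_def)
  also have "wz_term x 1 = summand_weight (Suc n) * D / 96" unfolding D_def x_def by (rule wz_term_1)
  also have "96 * (summand_weight (Suc n) * D / 96) * (5 * B * (P (x + 1) / D) + (5 * P (x + 1) * d - Q (x + 1) / ((3*x + 2) * (3*x + 1))) / D)
     = summand_weight (Suc n) * (5 * P (x + 1) * (B + d) - Q (x + 1) / ((3*x + 2) * (3*x + 1)))"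
  proof -
    have "96 * (W * D / 96) * (5 * B * (p / D) + (5 * p * d - t) / D) = W * (5 * p * (B + d) - t)" for W p t
      using D by (simp add: field_simps)
    thus ?thesis .
  qed
  also have "\<dots> = summand2 (Suc n)"
  proof -
    have r: "real (Suc n) = x + 1" "3 * (x + 1) - 1 = 3*x + 2" "3 * (x + 1) - 2 = 3*x + 1" by (simp_all add: x_def)
    show ?thesis unfolding summand2_def summand_weight_def h r by simp
  qed
  finally show ?thesis ..
qed

section \<open>The two series\<close>

theorem theorem1p16:
  shows "(\<lambda>n. summand1 (Suc n)) sums (96 * (3 * pi ^ 2 * ln 2 - 14 * zeta 3))
       \<and> (\<lambda>n. summand2 (Suc n)) sums (192 * (7 * zeta 3 + 6 * pi ^ 2 * ln 2))"
proof
  have mate: "(\<lambda>n. 96 * wz_mate_deriv g a b (real n) 1) sums (96 * (g * pi^2 / 2 - 14 * (a + b) * zeta 3))" for g a b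
    by (intro sums_mult sum_wz_mate_deriv wz_term_deriv_0_sums)
  show "(\<lambda>n. summand1 (Suc n)) sums (96 * (3 * pi ^ 2 * ln 2 - 14 * zeta 3))"
    using mate[of "6 * ln 2" "-1/2" "3/2"] unfolding summand1_eq by (simp add: algebra_simps)
  show "(\<lambda>n. summand2 (Suc n)) sums (192 * (7 * zeta 3 + 6 * pi ^ 2 * ln 2))"
    using mate[of "24 * ln 2" "-2" "1"] unfolding summand2_eq by (simp add: algebra_simps)
qed

end
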